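(* Let $A$ be a finite dimensional (not necessarily associative) algebra over a field of characteristic $0$ graded by a set $T$. Then $$\ell_n^{T\text{-}\mathrm{gr}}(A)\le(\dim A)(n+1)^{(\dim A)^2+\dim A}$$ for all $n\in\mathbb N$.
   Context: $\mathbb N$ is the set of positive integers. Let $T$ be a set and $F$ a field. An algebra $A$ over $F$ (not necessarily associative) is graded by $T$ ($T$-graded) if a decomposition $A=\bigoplus_{t\in T}A^{(t)}$ into a direct sum of subspaces is fixed such that for every $s,t\in T$ there exists $r\in T$ with $A^{(s)}A^{(t)}\subseteq A^{(r)}$ (no operation on $T$ is assumed). Let $F\{X^{T\text{-}\mathrm{gr}}\}$ be the absolutely free non-associative $F$-algebra on the disjoint union $X^{T\text{-}\mathrm{gr}}=\bigsqcup_{t\in T}X^{(t)}$, $X^{(t)}=\{x_1^{(t)},x_2^{(t)},\dots\}$. An element $f=f(x_{i_1}^{(t_1)},\dots,x_{i_s}^{(t_s)})$ is a graded polynomial identity of $A$ if $f(a_1,\dots,a_s)=0$ for all $a_j\in A^{(t_j)}$; the ideal of these is $\mathrm{Id}^{T\text{-}\mathrm{gr}}(A)$. Let $W_n^{T\text{-}\mathrm{gr}}$ be the span of all $x_{\sigma(1)}^{(t_1)}\cdots x_{\sigma(n)}^{(t_n)}$, $t_i\in T$, $\sigma\in S_n$, with all arrangements of brackets. The group $S_n$ acts on $\frac{W_n^{T\text{-}\mathrm{gr}}}{W_n^{T\text{-}\mathrm{gr}}\cap\mathrm{Id}^{T\text{-}\mathrm{gr}}(A)}$ by $\sigma\, x_{i_1}^{(t_1)}\cdots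 x_{i_n}^{(t_n)}:=x_{\sigma(i_1)}^{(t_1)}\cdots x_{\sigma(i_n)}^{(t_n)}$. In characteristic $0$, $m(A,T\text{-}\mathrm{gr},\lambda)$ is the multiplicity in this $FS_n$-module of the irreducible module corresponding to $\lambda\vdash n$, and the $n$th colength of graded polynomial identities is $\ell_n^{T\text{-}\mathrm{gr}}(A):=\sum_{\lambda\vdash n}m(A,T\text{-}\mathrm{gr},\lambda)$. *)

theory Defs
  imports Complex_Main "HOL-Library.Poly_Mapping" "HOL-Algebra.Sym_Groups" "HOL-Algebra.Module"
    "HOL-Algebra.AbelCoset"
begin

section \<open>Graded algebras\<close>

locale nonassoc_algebra = vector_space scale
  for scale :: "'f::field \<Rightarrow> 'a::ab_group_add \<Rightarrow> 'a" +
  fixes mul :: "'a \<Rightarrow> 'a \<Rightarrow> 'a"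
  assumes linear_right: "Vector_Spaces.linear scale scale (\<lambda>b. mul a b)"
    and linear_left: "Vector_Spaces.linear scale scale (\<lambda>a. mul a b)"

text \<open>The finitely supported family \<open>c\<close> below collects the homogeneous components of \<open>a\<close>; its
  existence and uniqueness say that the whole algebra is the direct sum of the \<open>A t\<close>,
  \<open>t \<in> T\<close>. The values of \<open>A\<close> outside \<open>T\<close> are irrelevant.\<close>

locale graded_algebra = nonassoc_algebra scale mul
  for scale :: "'f::field \<Rightarrow> 'a::ab_group_add \<Rightarrow> 'a" and mul :: "'a \<Rightarrow> 'a \<Rightarrow> 'a" +
  fixes T :: "'t set" and A :: "'t \<Rightarrow> 'a set"
  assumes subspace_component: "t \<in> T \<Longrightarrow> subspace (A t)"
    and direct_sum: "\<exists>!c :: 't \<Rightarrow>\<^sub>0 'a. Poly_Mapping.keys c \<subseteq> T \<and>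
      (\<forall>t\<in>T. Poly_Mapping.lookup c t \<in> A t) \<and>
      a = (\<Sum>t\<in>Poly_Mapping.keys c. Poly_Mapping.lookup c t)"
    and mult_component: "s \<in> T \<Longrightarrow> t \<in> T \<Longrightarrow>
      \<exists>r\<in>T. \<forall>a\<in>A s. \<forall>b\<in>A t. mul a b \<in> A r"

section \<open>Graded polynomials and graded identities\<close>

text \<open>The pair \<open>(i, t)\<close> with \<open>i \<ge> 1\<close> and \<open>t \<in> T\<close> is the variable \<open>x\<close> with lower index \<open>i\<close> and
  degree \<open>t\<close>. The absolutely free non-associative algebra (without unit) has the bracketed
  words in the variables as a basis; its elements are finitely supported coefficient functions.\<close>

datatype 'x word = Var 'x | Mul "'x word" "'x word"

fun letters :: "'x word \<Rightarrow> 'x list" where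
  "letters (Var x) = [x]"
| "letters (Mul u v) = letters u @ letters v"

definition graded_vars :: "'t set \<Rightarrow> (nat \<times> 't) set" where
  "graded_vars T = {1..} \<times> T"

definition free_algebra :: "'x set \<Rightarrow> ('x word \<Rightarrow>\<^sub>0 'f::zero) set" where
  "free_algebra X = {f. \<forall>w\<in>Poly_Mapping.keys f. set (letters w) \<subseteq> X}"

definition coeff_scale :: "'f::mult_zero \<Rightarrow> ('k \<Rightarrow>\<^sub>0 'f) \<Rightarrow> ('k \<Rightarrow>\<^sub>0 'f)" where
  "coeff_scale c f = Poly_Mapping.map (\<lambda>d. c * d) f"

primrec eval_word :: "('a \<Rightarrow> 'a \<Rightarrow> 'a) \<Rightarrow> ('x \<Rightarrow> 'a) \<Rightarrow> 'x word \<Rightarrow> 'a" where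
  "eval_word mul \<psi> (Var x) = \<psi> x"
| "eval_word mul \<psi> (Mul u v) = mul (eval_word mul \<psi> u) (eval_word mul \<psi> v)"

definition eval_poly :: "('f::zero \<Rightarrow> 'a::comm_monoid_add \<Rightarrow> 'a) \<Rightarrow> ('a \<Rightarrow> 'a \<Rightarrow> 'a) \<Rightarrow>
    ('x \<Rightarrow> 'a) \<Rightarrow> ('x word \<Rightarrow>\<^sub>0 'f) \<Rightarrow> 'a" where
  "eval_poly scale mul \<psi> f =
    (\<Sum>w\<in>Poly_Mapping.keys f. scale (Poly_Mapping.lookup f w) (eval_word mul \<psi> w))"

definition graded_identities :: "('f::zero \<Rightarrow> 'a::comm_monoid_add \<Rightarrow> 'a) \<Rightarrow> ('a \<Rightarrow> 'a \<Rightarrow> 'a) \<Rightarrow>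
    't set \<Rightarrow> ('t \<Rightarrow> 'a set) \<Rightarrow> ((nat \<times> 't) word \<Rightarrow>\<^sub>0 'f) set" where
  "graded_identities scale mul T A = {f \<in> free_algebra (graded_vars T).
    \<forall>\<psi>. (\<forall>(i, t)\<in>graded_vars T. \<psi> (i, t) \<in> A t) \<longrightarrow> eval_poly scale mul \<psi> f = 0}"

definition multilinear_words :: "nat \<Rightarrow> 't set \<Rightarrow> (nat \<times> 't) word set" where
  "multilinear_words n T = {w. \<exists>p\<in>carrier (sym_group n). \<exists>t\<in>{1..n} \<rightarrow> T.
    letters w = map (\<lambda>j. (p j, t j)) [1..<n + 1]}"

definition multilinear_polys :: "nat \<Rightarrow> 't set \<Rightarrow> ((nat \<times> 't) word \<Rightarrow>\<^sub>0 'f::zero) set" where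
  "multilinear_polys n T = {f. Poly_Mapping.keys f \<subseteq> multilinear_words n T}"

definition rename_poly ::
    "(nat \<Rightarrow> nat) \<Rightarrow> ((nat \<times> 't) word \<Rightarrow>\<^sub>0 'f::comm_monoid_add) \<Rightarrow> ((nat \<times> 't) word \<Rightarrow>\<^sub>0 'f)" where
  "rename_poly p f = (\<Sum>w\<in>Poly_Mapping.keys f.
    Poly_Mapping.single (map_word (\<lambda>(i, t). (p i, t)) w) (Poly_Mapping.lookup f w))"

section \<open>Modules over the group algebra of the symmetric group\<close>

text \<open>A module over the group algebra of \<open>sym_group n\<close> is recorded as a vector space over the
  field \<open>'f\<close> together with the action of the permutations; the ring multiplication and unit
  inherited from \<^type>\<open>module\<close> play no role.\<close>

record ('f, 'v) sn_module = "('f, 'v) module" +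
  act :: "(nat \<Rightarrow> nat) \<Rightarrow> 'v \<Rightarrow> 'v"

definition sn_submodule :: "nat \<Rightarrow> ('f, 'v) sn_module \<Rightarrow> 'v set \<Rightarrow> bool" where
  "sn_submodule n M U \<longleftrightarrow> subgroup U (add_monoid M) \<and>
    (\<forall>c. \<forall>u\<in>U. c \<odot>\<^bsub>M\<^esub> u \<in> U) \<and>
    (\<forall>p\<in>carrier (sym_group n). \<forall>u\<in>U. act M p u \<in> U)"

definition sn_irreducible :: "nat \<Rightarrow> ('f, 'v) sn_module \<Rightarrow> bool" where
  "sn_irreducible n M \<longleftrightarrow> carrier M \<noteq> {\<zero>\<^bsub>M\<^esub>} \<and>
    (\<forall>U. sn_submodule n M U \<longrightarrow> U = {\<zero>\<^bsub>M\<^esub>} \<or> U = carrier M)"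

definition sn_isomorphic :: "nat \<Rightarrow> ('f, 'v) sn_module \<Rightarrow> ('f, 'w) sn_module \<Rightarrow> bool" where
  "sn_isomorphic n M N \<longleftrightarrow> (\<exists>\<phi>. bij_betw \<phi> (carrier M) (carrier N) \<and>
    (\<forall>u\<in>carrier M. \<forall>v\<in>carrier M. \<phi> (u \<oplus>\<^bsub>M\<^esub> v) = \<phi> u \<oplus>\<^bsub>N\<^esub> \<phi> v) \<and>
    (\<forall>c. \<forall>u\<in>carrier M. \<phi> (c \<odot>\<^bsub>M\<^esub> u) = c \<odot>\<^bsub>N\<^esub> \<phi> u) \<and>
    (\<forall>p\<in>carrier (sym_group n). \<forall>u\<in>carrier M. \<phi> (act M p u) = act N p (\<phi> u)))"

definition sn_quotient :: "('f, 'v) sn_module \<Rightarrow> 'v set \<Rightarrow> ('f, 'v set) sn_module" where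
  "sn_quotient M N = \<lparr>carrier = a_rcosets\<^bsub>M\<^esub> N, mult = undefined, one = undefined,
    zero = N, add = set_add M,
    smult = (\<lambda>c X. \<Union>x\<in>X. N +>\<^bsub>M\<^esub> (c \<odot>\<^bsub>M\<^esub> x)),
    act = (\<lambda>p X. \<Union>x\<in>X. N +>\<^bsub>M\<^esub> act M p x)\<rparr>"

definition irreducible_decomposition ::
    "nat \<Rightarrow> ('f, 'v) sn_module \<Rightarrow> 'v set set \<Rightarrow> bool" where
  "irreducible_decomposition n M D \<longleftrightarrow> finite D \<and>
    (\<forall>U\<in>D. sn_submodule n M U \<and> sn_irreducible n (M\<lparr>carrier := U\<rparr>)) \<and>
    (\<forall>v\<in>carrier M. \<exists>!u. u \<in> (\<Pi>\<^sub>E U\<in>D. U) \<and> v = (\<Oplus>\<^bsub>M\<^esub>U\<in>D. u U))"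

text \<open>A finite-dimensional module in characteristic \<open>0\<close> has a decomposition into irreducible
  submodules (Maschke), and the number of summands isomorphic to \<open>S\<close> is the same for all
  decompositions (Krull-Schmidt), so the choice made below is immaterial.\<close>

definition sn_multiplicity :: "nat \<Rightarrow> ('f, 'v) sn_module \<Rightarrow> ('f, 'w) sn_module \<Rightarrow> nat" where
  "sn_multiplicity n M S = (SOME m. \<exists>D. irreducible_decomposition n M D \<and>
    m = card {U \<in> D. sn_isomorphic n (M\<lparr>carrier := U\<rparr>) S})"

section \<open>Partitions and the corresponding irreducible modules\<close>

definition partitions :: "nat \<Rightarrow> nat list set" where
  "partitions n = {\<mu>. sorted_wrt (\<ge>) \<mu> \<and> (\<forall>k\<in>set \<mu>. k \<ge> 1) \<and> sum_list \<mu> = n}"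

text \<open>The Young tableau of shape \<open>\<mu>\<close> in which \<open>1, \<dots>, n\<close> are written row by row. Rows are counted
  from \<open>0\<close>, columns from \<open>1\<close>.\<close>

definition tableau_row :: "nat list \<Rightarrow> nat \<Rightarrow> nat set" where
  "tableau_row \<mu> i = {sum_list (take i \<mu>) + j | j. 1 \<le> j \<and> j \<le> \<mu> ! i}"

definition tableau_column :: "nat list \<Rightarrow> nat \<Rightarrow> nat set" where
  "tableau_column \<mu> j = {sum_list (take i \<mu>) + j | i. i < length \<mu> \<and> j \<le> \<mu> ! i}"

definition row_stabilizer :: "nat list \<Rightarrow> (nat \<Rightarrow> nat) set" where
  "row_stabilizer \<mu> = {p \<in> carrier (sym_group (sum_list \<mu>)).
    \<forall>i<length \<mu>. p ` tableau_row \<mu> i = tableau_row \<mu> i}"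

definition column_stabilizer :: "nat list \<Rightarrow> (nat \<Rightarrow> nat) set" where
  "column_stabilizer \<mu> = {p \<in> carrier (sym_group (sum_list \<mu>)).
    \<forall>j\<ge>1. p ` tableau_column \<mu> j = tableau_column \<mu> j}"

definition group_algebra :: "nat \<Rightarrow> ((nat \<Rightarrow> nat) \<Rightarrow>\<^sub>0 'f::zero) set" where
  "group_algebra n = {f. Poly_Mapping.keys f \<subseteq> carrier (sym_group n)}"

definition group_algebra_mult :: "((nat \<Rightarrow> nat) \<Rightarrow>\<^sub>0 'f::semiring_0) \<Rightarrow>
    ((nat \<Rightarrow> nat) \<Rightarrow>\<^sub>0 'f) \<Rightarrow> ((nat \<Rightarrow> nat) \<Rightarrow>\<^sub>0 'f)" where
  "group_algebra_mult f g = (\<Sum>p\<in>Poly_Mapping.keys f. \<Sum>q\<in>Poly_Mapping.keys g.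
    Poly_Mapping.single (p \<circ> q) (Poly_Mapping.lookup f p * Poly_Mapping.lookup g q))"

definition young_symmetrizer :: "nat list \<Rightarrow> ((nat \<Rightarrow> nat) \<Rightarrow>\<^sub>0 'f::comm_ring_1)" where
  "young_symmetrizer \<mu> = (\<Sum>p\<in>row_stabilizer \<mu>. \<Sum>q\<in>column_stabilizer \<mu>.
    Poly_Mapping.single (p \<circ> q) (of_int (sign q)))"

text \<open>The irreducible module of the partition \<open>\<mu>\<close> is the left ideal of the group algebra
  generated by the Young symmetrizer; another tableau of the same shape gives an isomorphic one.\<close>

definition specht_module :: "nat list \<Rightarrow> ('f::comm_ring_1, (nat \<Rightarrow> nat) \<Rightarrow>\<^sub>0 'f) sn_module" where
  "specht_module \<mu> = \<lparr>
    carrier = {group_algebra_mult f (young_symmetrizer \<mu>) | f. f \<in> group_algebra (sum_list \<mu>)},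
    mult = undefined, one = undefined, zero = 0, add = (+), smult = coeff_scale,
    act = (\<lambda>p. group_algebra_mult (Poly_Mapping.single p 1))\<rparr>"

section \<open>Graded cocharacter multiplicities and colengths\<close>

definition multilinear_module ::
    "nat \<Rightarrow> 't set \<Rightarrow> ('f::comm_ring_1, (nat \<times> 't) word \<Rightarrow>\<^sub>0 'f) sn_module" where
  "multilinear_module n T = \<lparr>carrier = multilinear_polys n T, mult = undefined, one = undefined,
    zero = 0, add = (+), smult = coeff_scale, act = rename_poly\<rparr>"

definition graded_cocharacter_module :: "('f::comm_ring_1 \<Rightarrow> 'a::comm_monoid_add \<Rightarrow> 'a) \<Rightarrow>
    ('a \<Rightarrow> 'a \<Rightarrow> 'a) \<Rightarrow> 't set \<Rightarrow> ('t \<Rightarrow> 'a set) \<Rightarrow> nat \<Rightarrow>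
    ('f, ((nat \<times> 't) word \<Rightarrow>\<^sub>0 'f) set) sn_module" where
  "graded_cocharacter_module scale mul T A n = sn_quotient (multilinear_module n T)
    (multilinear_polys n T \<inter> graded_identities scale mul T A)"

definition graded_multiplicity :: "('f::comm_ring_1 \<Rightarrow> 'a::comm_monoid_add \<Rightarrow> 'a) \<Rightarrow>
    ('a \<Rightarrow> 'a \<Rightarrow> 'a) \<Rightarrow> 't set \<Rightarrow> ('t \<Rightarrow> 'a set) \<Rightarrow> nat list \<Rightarrow> nat" where
  "graded_multiplicity scale mul T A \<mu> = sn_multiplicity (sum_list \<mu>)
    (graded_cocharacter_module scale mul T A (sum_list \<mu>)) (specht_module \<mu>)"

definition graded_colength :: "('f::comm_ring_1 \<Rightarrow> 'a::comm_monoid_add \<Rightarrow> 'a) \<Rightarrow>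
    ('a \<Rightarrow> 'a \<Rightarrow> 'a) \<Rightarrow> 't set \<Rightarrow> ('t \<Rightarrow> 'a set) \<Rightarrow> nat \<Rightarrow> nat" where
  "graded_colength scale mul T A n =
    (\<Sum>\<mu>\<in>partitions n. graded_multiplicity scale mul T A \<mu>)"

end

theory Submission
  imports Defs "HOL-Library.Function_Algebras"
begin

text \<open>
  Let \<open>d\<close> be the dimension of the algebra and fix a basis. Evaluating a multilinear polynomial on
  tuples of basis elements, the variable of index \<open>i\<close> and degree \<open>t\<close> being replaced by the
  \<open>t\<close>-component of the \<open>i\<close>-th entry, embeds the graded cocharacter module into \<open>d\<close> copies of the
  dual of the \<open>n\<close>-th tensor power, on which \<open>S\<^sub>n\<close> permutes the places.

  An irreducible summand isomorphic to the Specht module of \<open>\<mu>\<close> contains a nonzero vector on which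
  the column stabilizer acts by signs. Such a multilinear function vanishes when \<open>\<mu>\<close> has more than
  \<open>d\<close> rows. It also contains a nonzero vector fixed by the row stabilizer. For different summands
  these vectors are independent, and a fixed function depends only on how often each basis element
  occurs in each row; hence the multiplicity of \<open>\<mu>\<close> is at most \<open>d (n + 1)\<close> to the power \<open>d\<^sup>2\<close>. There
  are at most \<open>(n + 1)\<close> to the power \<open>d\<close> partitions with at most \<open>d\<close> parts.
\<close>

section \<open>Isomorphisms of modules\<close>

text \<open>The obstacle is the grading: the degree attached to an index changes from word to word,
  and \<open>T\<close> may be infinite, so the multilinear polynomials need not form a finite
  dimensional space. Because each index occurs exactly once in every word, one vector per index can
  carry the values for all degrees at once. The grading then disappears into a multilinear function
  of \<open>n\<close> arbitrary vectors, and the bound sees only the dimension, not the size of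
  \<open>T\<close>.

  The two special vectors of a Specht module come from the form of the Young symmetrizer: it is
  \<open>a b\<close> with \<open>a\<close> the sum over row permutations and \<open>b\<close> the
  signed sum over column permutations. Row permutations fix \<open>a b\<close> from the left, and
  column permutations act by signs on \<open>b a b\<close>. That \<open>b a b\<close> is not zero is
  read off from its coefficient at the identity.

  The multiplicity is defined by choosing some decomposition into irreducibles. Averaging over the
  group shows that there is one to choose, and the bound is proved for every decomposition.\<close>

definition sn_iso ::
    "nat \<Rightarrow> ('v \<Rightarrow> 'w) \<Rightarrow> ('f, 'v) sn_module \<Rightarrow> ('f, 'w) sn_module \<Rightarrow> bool" where
  "sn_iso n \<phi> M N \<longleftrightarrow> bij_betw \<phi> (carrier M) (carrier N) \<and>
    (\<forall>u\<in>carrier M. \<forall>v\<in>carrier M. \<phi> (u \<oplus>\<^bsub>M\<^esub> v) = \<phi> u \<oplus>\<^bsub>N\<^esub> \<phi> v) \<and>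
    (\<forall>c. \<forall>u\<in>carrier M. \<phi> (c \<odot>\<^bsub>M\<^esub> u) = c \<odot>\<^bsub>N\<^esub> \<phi> u) \<and>
    (\<forall>p\<in>carrier (sym_group n). \<forall>u\<in>carrier M. \<phi> (act M p u) = act N p (\<phi> u))"

lemma sn_isomorphic_iff: "sn_isomorphic n M N \<longleftrightarrow> (\<exists>\<phi>. sn_iso n \<phi> M N)"
  unfolding sn_isomorphic_def sn_iso_def by simp

text \<open>The records carry no module axioms, so closure of \<open>carrier M\<close> under the
  operations has to be supplied; it is phrased as \<open>carrier M\<close> being a submodule of
  \<open>M\<close>. With it, \<open>gI\<close> identifies each required preimage from its
  image.\<close>

lemma sn_iso_inv:
  assumes iso: "sn_iso n \<phi> M N" and sub: "sn_submodule n M (carrier M)"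
  shows "sn_iso n (the_inv_into (carrier M) \<phi>) N M"
proof -
  let ?g = "the_inv_into (carrier M) \<phi>"
  have bij: "bij_betw \<phi> (carrier M) (carrier N)" and inj: "inj_on \<phi> (carrier M)"
    using iso by (auto simp: sn_iso_def bij_betw_def)
  have g: "?g v \<in> carrier M" "\<phi> (?g v) = v" if "v \<in> carrier N" for v
    using bij that by (auto simp: bij_betw_def the_inv_into_into f_the_inv_into_f)
  have gI: "?g v = u" if "u \<in> carrier M" "\<phi> u = v" for u v
    using that inj by (auto simp: the_inv_into_f_f)
  have cl: "\<And>u v. u \<in> carrier M \<Longrightarrow> v \<in> carrier M \<Longrightarrow> u \<oplus>\<^bsub>M\<^esub> v \<in> carrier M"
    "\<And>c u. u \<in> carrier M \<Longrightarrow> c \<odot>\<^bsub>M\<^esub> u \<in> carrier M"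
    "\<And>p u. p \<in> carrier (sym_group n) \<Longrightarrow> u \<in> carrier M \<Longrightarrow> act M p u \<in> carrier M"
    using sub subgroup.m_closed[of "carrier M" "add_monoid M"] by (auto simp: sn_submodule_def)
  show ?thesis unfolding sn_iso_def
  proof (intro conjI ballI allI)
    show "bij_betw ?g (carrier N) (carrier M)" using bij by (rule bij_betw_the_inv_into)
  qed (rule gI; use iso g cl in \<open>simp add: sn_iso_def\<close>)+
qed

lemma sn_iso_trans:
  assumes "sn_iso n \<phi> M N" "sn_iso n \<psi> N L"
  shows "sn_iso n (\<psi> \<circ> \<phi>) M L"
proof -
  have "\<phi> u \<in> carrier N" if "u \<in> carrier M" for u
    using assms(1) that by (auto simp: sn_iso_def bij_betw_def)
  then show ?thesis
    using assms by (auto simp: sn_iso_def intro: bij_betw_trans)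
qed

lemma abelian_group_restrict:
  fixes M :: "('f, 'v) sn_module"
  assumes "abelian_group M" "subgroup U (add_monoid M)"
  shows "abelian_group (M\<lparr>carrier := U\<rparr>)"
proof -
  interpret M: abelian_group M by fact
  have "comm_group ((add_monoid M)\<lparr>carrier := U\<rparr>)"
    by (rule group.group_comm_groupI[OF M.add.subgroup_imp_group[OF assms(2)]])
      (use M.add.m_comm subgroup.subset[OF assms(2)] in auto)
  then show ?thesis
    by (intro abelian_group.intro abelian_monoid.intro abelian_group_axioms.intro)
      (simp_all add: comm_group_def)
qed

lemma subgroup_restrict_iff:
  assumes "abelian_group M" "subgroup U (add_monoid M)"
  shows "subgroup V (add_monoid (M\<lparr>carrier := U\<rparr>)) \<longleftrightarrow> subgroup V (add_monoid M) \<and> V \<subseteq> U"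
proof -
  interpret M: abelian_group M by fact
  have "subgroup V ((add_monoid M)\<lparr>carrier := U\<rparr>) \<longleftrightarrow> subgroup V (add_monoid M) \<and> V \<subseteq> U"
    using M.add.incl_subgroup[OF assms(2)] M.add.subgroup_incl[OF _ assms(2)]
      subgroup.subset[of V "(add_monoid M)\<lparr>carrier := U\<rparr>"]
    by (metis partial_object.select_convs(1) partial_object.simps(3))
  then show ?thesis by simp
qed

lemma sn_submodule_restrict_iff:
  fixes M :: "('f, 'v) sn_module"
  assumes "abelian_group M" "sn_submodule n M U"
  shows "sn_submodule n (M\<lparr>carrier := U\<rparr>) V \<longleftrightarrow> sn_submodule n M V \<and> V \<subseteq> U"
  using subgroup_restrict_iff[of M U V] assms by (auto simp: sn_submodule_def)

section \<open>Transport of submodules and decompositions along an isomorphism\<close>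

locale sn_iso_pair =
  fixes n :: nat and \<phi> :: "'v \<Rightarrow> 'w" and M :: "('f, 'v) sn_module" and N :: "('f, 'w) sn_module"
  assumes group_M: "abelian_group M" and group_N: "abelian_group N" and iso: "sn_iso n \<phi> M N"
begin

sublocale M: abelian_group M by (rule group_M)
sublocale N: abelian_group N by (rule group_N)

sublocale hom: group_hom "add_monoid M" "add_monoid N" \<phi>
  using iso by unfold_locales (auto simp: hom_def sn_iso_def bij_betw_def)

lemma inj: "inj_on \<phi> (carrier M)" and image_carrier: "\<phi> ` carrier M = carrier N"
  using iso by (auto simp: sn_iso_def bij_betw_def)

lemma image_smult: "u \<in> carrier M \<Longrightarrow> \<phi> (c \<odot>\<^bsub>M\<^esub> u) = c \<odot>\<^bsub>N\<^esub> \<phi> u"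
  and image_act: "p \<in> carrier (sym_group n) \<Longrightarrow> u \<in> carrier M \<Longrightarrow> \<phi> (act M p u) = act N p (\<phi> u)"
  using iso by (auto simp: sn_iso_def)

lemma image_zero: "\<phi> \<zero>\<^bsub>M\<^esub> = \<zero>\<^bsub>N\<^esub>"
  using hom.hom_one by simp

lemma sn_submodule_image:
  assumes "sn_submodule n M U"
  shows "sn_submodule n N (\<phi> ` U)"
proof -
  have U: "subgroup U (add_monoid M)" "U \<subseteq> carrier M"
    using assms subgroup.subset[of U "add_monoid M"] by (auto simp: sn_submodule_def)
  show ?thesis unfolding sn_submodule_def
  proof (intro conjI ballI allI)
    show "subgroup (\<phi> ` U) (add_monoid N)"
      using hom.subgroup_img_is_subgroup[OF U(1)] .
  next
    fix c v assume "v \<in> \<phi> ` U"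
    then obtain u where u: "u \<in> U" "v = \<phi> u" by blast
    then have "c \<odot>\<^bsub>N\<^esub> v = \<phi> (c \<odot>\<^bsub>M\<^esub> u)" using U image_smult by auto
    then show "c \<odot>\<^bsub>N\<^esub> v \<in> \<phi> ` U" using assms u by (auto simp: sn_submodule_def)
  next
    fix p v assume p: "p \<in> carrier (sym_group n)" and "v \<in> \<phi> ` U"
    then obtain u where u: "u \<in> U" "v = \<phi> u" by blast
    then have "act N p v = \<phi> (act M p u)" using U p image_act by auto
    then show "act N p v \<in> \<phi> ` U" using assms u p by (auto simp: sn_submodule_def)
  qed
qed

lemma sn_iso_restrict:
  assumes "U \<subseteq> carrier M"
  shows "sn_iso n \<phi> (M\<lparr>carrier := U\<rparr>) (N\<lparr>carrier := \<phi> ` U\<rparr>)"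
  using iso assms by (auto simp: sn_iso_def bij_betw_def inj_on_subset subset_iff)

text \<open>Each submodule \<open>V\<close> of \<open>N\<close> is the image of its image under the
  inverse map, so a proper nonzero \<open>V\<close> would give a proper nonzero submodule of
  \<open>M\<close>.\<close>

lemma sn_irreducible_image:
  assumes irr: "sn_irreducible n M" and sub: "sn_submodule n M (carrier M)"
  shows "sn_irreducible n N"
proof -
  let ?g = "the_inv_into (carrier M) \<phi>"
  interpret inv: sn_iso_pair n ?g N M
    by (intro sn_iso_pair.intro group_M group_N sn_iso_inv iso sub)
  have "carrier N \<noteq> {\<zero>\<^bsub>N\<^esub>}"
  proof
    assume *: "carrier N = {\<zero>\<^bsub>N\<^esub>}"
    have "carrier M = ?g ` carrier N" using inv.image_carrier by simp
    also have "\<dots> = {\<zero>\<^bsub>M\<^esub>}" using * inv.image_zero by simp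
    finally show False using irr by (simp add: sn_irreducible_def)
  qed
  moreover have "V = {\<zero>\<^bsub>N\<^esub>} \<or> V = carrier N" if V: "sn_submodule n N V" for V
  proof -
    have "V \<subseteq> carrier N"
      using V subgroup.subset[of V "add_monoid N"] by (auto simp: sn_submodule_def)
    then have "\<phi> (?g v) = v" if "v \<in> V" for v
      using that inj image_carrier by (auto intro!: f_the_inv_into_f)
    then have eq: "V = \<phi> ` (?g ` V)" by (simp add: image_image)
    have "?g ` V = {\<zero>\<^bsub>M\<^esub>} \<or> ?g ` V = carrier M"
      using irr inv.sn_submodule_image[OF V] by (auto simp: sn_irreducible_def)
    then show ?thesis
      using eq image_zero image_carrier by auto
  qed
  ultimately show ?thesis by (simp add: sn_irreducible_def)
qed

lemma image_finsum:
  assumes "finite D" "u \<in> D \<rightarrow> carrier M"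
  shows "\<phi> (\<Oplus>\<^bsub>M\<^esub>U\<in>D. u U) = (\<Oplus>\<^bsub>N\<^esub>U\<in>D. \<phi> (u U))"
  using assms
proof (induction D rule: finite_induct)
  case (insert x F)
  have "(\<lambda>U. \<phi> (u U)) \<in> insert x F \<rightarrow> carrier N" using insert.prems image_carrier by auto
  moreover have "\<phi> (u x \<oplus>\<^bsub>M\<^esub> v) = \<phi> (u x) \<oplus>\<^bsub>N\<^esub> \<phi> v" if "v \<in> carrier M" for v
    using hom.hom_mult[of "u x" v] insert.prems that by auto
  ultimately show ?case using insert by (simp add: Pi_iff)
qed (simp add: image_zero)

lemma irreducible_decomposition_image:
  assumes dec: "irreducible_decomposition n M D"
  shows "irreducible_decomposition n N ((`) \<phi> ` D)"
proof -
  have fin: "finite D" and sub: "\<And>U. U \<in> D \<Longrightarrow> sn_submodule n M U"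
    and irr: "\<And>U. U \<in> D \<Longrightarrow> sn_irreducible n (M\<lparr>carrier := U\<rparr>)"
    and uniq: "\<And>v. v \<in> carrier M \<Longrightarrow> \<exists>!u. u \<in> (\<Pi>\<^sub>E U\<in>D. U) \<and> v = (\<Oplus>\<^bsub>M\<^esub>U\<in>D. u U)"
    using dec by (auto simp: irreducible_decomposition_def)
  have subset: "U \<subseteq> carrier M" if "U \<in> D" for U
    using sub[OF that] subgroup.subset[of U "add_monoid M"] by (auto simp: sn_submodule_def)
  \<comment> \<open>Summands form a set, so distinct summands must keep distinct images.\<close>
  have injD: "inj_on ((`) \<phi>) D"
    by (intro inj_onI) (metis inj inj_on_image_eq_iff subset)
  have "sn_irreducible n (N\<lparr>carrier := \<phi> ` U\<rparr>)" if U: "U \<in> D" for U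
  proof -
    have "subgroup U (add_monoid M)" "subgroup (\<phi> ` U) (add_monoid N)"
      using sub[OF U] sn_submodule_image[OF sub[OF U]] by (auto simp: sn_submodule_def)
    then interpret r: sn_iso_pair n \<phi> "M\<lparr>carrier := U\<rparr>" "N\<lparr>carrier := \<phi> ` U\<rparr>"
      by (intro sn_iso_pair.intro abelian_group_restrict group_M group_N sn_iso_restrict subset[OF U])
    show ?thesis
      by (rule r.sn_irreducible_image[OF irr[OF U]])
        (simp add: sn_submodule_restrict_iff group_M sub[OF U])
  qed
  moreover have "\<exists>!u. u \<in> (\<Pi>\<^sub>E V\<in>(`) \<phi> ` D. V) \<and> v = (\<Oplus>\<^bsub>N\<^esub>V\<in>(`) \<phi> ` D. u V)"
    if v: "v \<in> carrier N" for v
  proof -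
    let ?g = "the_inv_into (carrier M) \<phi>"
    have re: "(\<Oplus>\<^bsub>N\<^esub>V\<in>(`) \<phi> ` D. u V) = (\<Oplus>\<^bsub>N\<^esub>U\<in>D. u (\<phi> ` U))"
      if u: "u \<in> (\<Pi>\<^sub>E V\<in>(`) \<phi> ` D. V)" for u
    proof (rule N.finsum_reindex[OF _ injD])
      have "V \<subseteq> carrier N" if "V \<in> (`) \<phi> ` D" for V
        using that subset image_carrier by blast
      then show "u \<in> (`) \<phi> ` D \<rightarrow> carrier N" using u unfolding PiE_iff by blast
    qed
    obtain w where w: "w \<in> carrier M" "v = \<phi> w"
      using v by (auto simp: image_carrier[symmetric])
    obtain x where x: "x \<in> (\<Pi>\<^sub>E U\<in>D. U)" "w = (\<Oplus>\<^bsub>M\<^esub>U\<in>D. x U)" using ex1_implies_ex[OF uniq[OF w(1)]] by blast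
    have xc: "x \<in> D \<rightarrow> carrier M" using x(1) subset by (auto simp: PiE_iff)
    \<comment> \<open>The components of \<open>w\<close>, relabelled by the images of the summands;
      the restriction makes the family extensional, as membership in the product demands.\<close>
    define y where "y = (\<lambda>V\<in>(`) \<phi> ` D. \<phi> (x (the_inv_into D ((`) \<phi>) V)))"
    have yU: "y (\<phi> ` U) = \<phi> (x U)" if "U \<in> D" for U
      using that by (simp add: y_def the_inv_into_f_f[OF injD])
    show ?thesis
    proof (intro ex1I conjI)
      show y: "y \<in> (\<Pi>\<^sub>E V\<in>(`) \<phi> ` D. V)"
        using yU x(1) by (auto simp: PiE_iff) (simp add: y_def)
      have "v = (\<Oplus>\<^bsub>N\<^esub>U\<in>D. \<phi> (x U))" using w x image_finsum[OF fin xc] by simp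
      also have "\<dots> = (\<Oplus>\<^bsub>N\<^esub>U\<in>D. y (\<phi> ` U))"
        by (rule N.finsum_cong') (use yU xc image_carrier in auto)
      finally show "v = (\<Oplus>\<^bsub>N\<^esub>V\<in>(`) \<phi> ` D. y V)" using re[OF y] by simp
    next
      fix z assume "z \<in> (\<Pi>\<^sub>E V\<in>(`) \<phi> ` D. V) \<and> v = (\<Oplus>\<^bsub>N\<^esub>V\<in>(`) \<phi> ` D. z V)"
      then have z: "z \<in> (\<Pi>\<^sub>E V\<in>(`) \<phi> ` D. V)" and vz: "v = (\<Oplus>\<^bsub>N\<^esub>U\<in>D. z (\<phi> ` U))"
        using re by auto
      define x' where "x' = (\<lambda>U\<in>D. ?g (z (\<phi> ` U)))"
      have x': "x' U \<in> U \<and> \<phi> (x' U) = z (\<phi> ` U)" if U: "U \<in> D" for U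
      proof -
        have "z (\<phi> ` U) \<in> \<phi> ` U" using z U by (auto simp: PiE_iff)
        then obtain u where u: "u \<in> U" "z (\<phi> ` U) = \<phi> u" by blast
        then have "?g (z (\<phi> ` U)) = u" using subset[OF U] inj by (auto simp: the_inv_into_f_f)
        then show ?thesis using u U by (simp add: x'_def)
      qed
      have x'c: "x' \<in> D \<rightarrow> carrier M" using x' subset by blast
      have "\<phi> w = (\<Oplus>\<^bsub>N\<^esub>U\<in>D. \<phi> (x' U))"
        unfolding w(2)[symmetric] vz by (rule N.finsum_cong') (use x' x'c image_carrier in auto)
      then have "\<phi> w = \<phi> (\<Oplus>\<^bsub>M\<^esub>U\<in>D. x' U)" using image_finsum[OF fin x'c] by simp
      then have "w = (\<Oplus>\<^bsub>M\<^esub>U\<in>D. x' U)"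
        using inj w(1) M.finsum_closed[OF x'c] by (auto dest: inj_onD)
      moreover have "x' \<in> (\<Pi>\<^sub>E U\<in>D. U)" using x' by (auto simp: PiE_iff x'_def)
      ultimately have "x' = x" using uniq[OF w(1)] x by blast
      then have "z V = y V" for V
        using x' yU z by (cases "V \<in> (`) \<phi> ` D") (auto simp: y_def PiE_iff extensional_def)
      then show "z = y" by blast
    qed
  qed
  ultimately show ?thesis
    using fin sub sn_submodule_image by (auto simp: irreducible_decomposition_def)
qed

text \<open>Composing with the inverse of the restricted isomorphism carries a summand isomorphic to
  \<open>S\<close> to another such summand. One inequality is enough, since only an upper bound for
  the count in \<open>M\<close> is wanted.\<close>

lemma card_isomorphic_summands_le:
  assumes dec: "irreducible_decomposition n M D"
  shows "card {U \<in> D. sn_isomorphic n (M\<lparr>carrier := U\<rparr>) S} \<le>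
    card {V \<in> (`) \<phi> ` D. sn_isomorphic n (N\<lparr>carrier := V\<rparr>) S}"
proof (rule card_inj_on_le)
  have sub: "sn_submodule n M U" if "U \<in> D" for U
    using dec that by (auto simp: irreducible_decomposition_def)
  have subset: "U \<subseteq> carrier M" if "U \<in> D" for U
    using sub[OF that] subgroup.subset[of U "add_monoid M"] by (auto simp: sn_submodule_def)
  show "inj_on ((`) \<phi>) {U \<in> D. sn_isomorphic n (M\<lparr>carrier := U\<rparr>) S}"
    by (intro inj_onI) (metis (mono_tags, lifting) inj inj_on_image_eq_iff mem_Collect_eq subset)
  show "(`) \<phi> ` {U \<in> D. sn_isomorphic n (M\<lparr>carrier := U\<rparr>) S}
      \<subseteq> {V \<in> (`) \<phi> ` D. sn_isomorphic n (N\<lparr>carrier := V\<rparr>) S}"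
  proof clarify
    fix U assume U: "U \<in> D" and "sn_isomorphic n (M\<lparr>carrier := U\<rparr>) S"
    then obtain \<psi> where \<psi>: "sn_iso n \<psi> (M\<lparr>carrier := U\<rparr>) S" by (auto simp: sn_isomorphic_iff)
    have "sn_submodule n (M\<lparr>carrier := U\<rparr>) (carrier (M\<lparr>carrier := U\<rparr>))"
      using sub[OF U] by (simp add: sn_submodule_restrict_iff[OF group_M])
    from sn_iso_trans[OF sn_iso_inv[OF sn_iso_restrict[OF subset[OF U]] this] \<psi>]
    have "sn_isomorphic n (N\<lparr>carrier := \<phi> ` U\<rparr>) S" by (auto simp: sn_isomorphic_iff)
    then show "\<phi> ` U \<in> (`) \<phi> ` D \<and> sn_isomorphic n (N\<lparr>carrier := \<phi> ` U\<rparr>) S" using U by blast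
  qed
  show "finite {V \<in> (`) \<phi> ` D. sn_isomorphic n (N\<lparr>carrier := V\<rparr>) S}"
    using dec by (auto simp: irreducible_decomposition_def)
qed

end

section \<open>Linear actions and Maschke's theorem\<close>

locale linear_sn_action = vector_space scl
  for scl :: "'f::field_char_0 \<Rightarrow> 'v::ab_group_add \<Rightarrow> 'v" +
  fixes n :: nat and \<rho> :: "(nat \<Rightarrow> nat) \<Rightarrow> 'v \<Rightarrow> 'v"
  assumes act_linear: "p permutes {1..n} \<Longrightarrow> Vector_Spaces.linear scl scl (\<rho> p)"
    and act_comp: "\<rho> (p \<circ> q) v = \<rho> p (\<rho> q v)"
    and act_id: "\<rho> id v = v"
begin

text \<open>All modules of this kind are subsets of one ambient vector space with the ambient
  operations. Changing the carrier stays within the family, and submodules become invariant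
  subspaces.\<close>

definition sn_mod :: "'v set \<Rightarrow> ('f, 'v) sn_module" where
  "sn_mod W = \<lparr>carrier = W, mult = undefined, one = undefined, zero = 0, add = (+),
    smult = scl, act = \<rho>\<rparr>"

definition invariant :: "'v set \<Rightarrow> bool" where
  "invariant W \<longleftrightarrow> subspace W \<and> (\<forall>p. p permutes {1..n} \<longrightarrow> \<rho> p ` W \<subseteq> W)"

lemma sn_mod_simps [simp]:
  "carrier (sn_mod W) = W" "\<zero>\<^bsub>sn_mod W\<^esub> = 0" "u \<oplus>\<^bsub>sn_mod W\<^esub> v = u + v"
  "c \<odot>\<^bsub>sn_mod W\<^esub> u = scl c u" "act (sn_mod W) = \<rho>" "(sn_mod W)\<lparr>carrier := U\<rparr> = sn_mod U"
  by (simp_all add: sn_mod_def)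

lemma abelian_group_sn_mod:
  assumes "subspace W"
  shows "abelian_group (sn_mod W)"
proof (rule abelian_groupI)
  fix x assume "x \<in> carrier (sn_mod W)"
  then show "\<exists>y\<in>carrier (sn_mod W). y \<oplus>\<^bsub>sn_mod W\<^esub> x = \<zero>\<^bsub>sn_mod W\<^esub>"
    by (intro bexI[of _ "- x"]) (use assms subspace_neg in auto)
qed (use assms subspace_add subspace_0 in \<open>auto simp: algebra_simps\<close>)

lemma sn_submodule_sn_mod:
  assumes W: "subspace W"
  shows "sn_submodule n (sn_mod W) U \<longleftrightarrow> invariant U \<and> U \<subseteq> W"
proof
  assume U: "sn_submodule n (sn_mod W) U"
  then have "subgroup U (add_monoid (sn_mod W))" by (simp add: sn_submodule_def)
  from subgroup.subset[OF this] subgroup.one_closed[OF this] subgroup.m_closed[OF this]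
  show "invariant U \<and> U \<subseteq> W"
    using U by (auto simp: sn_submodule_def invariant_def subspace_def sym_group_carrier)
next
  interpret abelian_group "sn_mod W" by (rule abelian_group_sn_mod[OF W])
  assume U: "invariant U \<and> U \<subseteq> W"
  then have sub: "subspace U" by (simp add: invariant_def)
  have "inv\<^bsub>add_monoid (sn_mod W)\<^esub> x = - x" if "x \<in> U" for x
    using minus_equality[of "- x" x] that U subspace_neg[OF sub] by (auto simp: a_inv_def)
  then have "subgroup U (add_monoid (sn_mod W))"
    using U sub by (intro subgroup.intro) (auto simp: subspace_def subspace_neg[OF sub])
  then show "sn_submodule n (sn_mod W) U"
    using U sub
    by (simp add: sn_submodule_def invariant_def subspace_scale sym_group_carrier image_subset_iff)
qed

lemma sn_irreducible_sn_mod: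
  assumes "subspace W"
  shows "sn_irreducible n (sn_mod W) \<longleftrightarrow>
    W \<noteq> {0} \<and> (\<forall>U. invariant U \<and> U \<subseteq> W \<longrightarrow> U = {0} \<or> U = W)"
  using assms by (simp add: sn_irreducible_def sn_submodule_sn_mod)

lemma finsum_sn_mod:
  assumes W: "subspace W" and "finite D" "u \<in> D \<rightarrow> W"
  shows "(\<Oplus>\<^bsub>sn_mod W\<^esub>U\<in>D. u U) = sum u D"
proof -
  interpret abelian_group "sn_mod W" by (rule abelian_group_sn_mod[OF W])
  show ?thesis using assms(2,3)
    by (induction D rule: finite_induct) (auto simp: Pi_iff)
qed

lemma irreducible_decomposition_sn_mod:
  assumes W: "subspace W"
  shows "irreducible_decomposition n (sn_mod W) D \<longleftrightarrow> finite D \<and>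
    (\<forall>U\<in>D. invariant U \<and> U \<subseteq> W \<and> sn_irreducible n (sn_mod U)) \<and>
    (\<forall>v\<in>W. \<exists>!u. u \<in> (\<Pi>\<^sub>E U\<in>D. U) \<and> v = sum u D)"
proof -
  have "u \<in> (\<Pi>\<^sub>E U\<in>D. U) \<and> v = (\<Oplus>\<^bsub>sn_mod W\<^esub>U\<in>D. u U) \<longleftrightarrow> u \<in> (\<Pi>\<^sub>E U\<in>D. U) \<and> v = sum u D"
    if "finite D" "\<forall>U\<in>D. U \<subseteq> W" for u v
  proof (rule conj_cong[OF refl])
    assume "u \<in> (\<Pi>\<^sub>E U\<in>D. U)"
    then have "u \<in> D \<rightarrow> W" using that by (auto simp: PiE_iff)
    then show "v = (\<Oplus>\<^bsub>sn_mod W\<^esub>U\<in>D. u U) \<longleftrightarrow> v = sum u D"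
      using finsum_sn_mod[OF W that(1)] by simp
  qed
  then show ?thesis
    unfolding irreducible_decomposition_def sn_submodule_sn_mod[OF W] sn_mod_simps conj_assoc
    by (intro conj_cong refl ball_cong) simp_all
qed

text \<open>Nonzero vectors from distinct summands of a direct sum are linearly independent. This
  bounds a number of summands by the dimension of a space that meets each of them.\<close>

lemma card_le_if_independent_summands:
  assumes W: "subspace W" and dec: "irreducible_decomposition n (sn_mod W) D"
    and E: "E \<subseteq> D" and x: "\<And>U. U \<in> E \<Longrightarrow> x U \<in> U \<and> x U \<noteq> 0 \<and> x U \<in> span S"
    and S: "finite S"
  shows "card E \<le> card S"
proof -
  have fin: "finite D" and sub: "\<And>U. U \<in> D \<Longrightarrow> subspace U"
    and uniq: "\<And>v. v \<in> W \<Longrightarrow> \<exists>!u. u \<in> (\<Pi>\<^sub>E U\<in>D. U) \<and> v = sum u D"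
    using dec unfolding irreducible_decomposition_sn_mod[OF W] by (auto simp: invariant_def)
  have finE: "finite E" using fin E finite_subset by blast
  have zero: "c U = 0" if sum0: "(\<Sum>U\<in>E. scl (c U) (x U)) = 0" and U: "U \<in> E" for c U
  proof -
    \<comment> \<open>A linear relation writes \<open>0\<close> both as \<open>sum u D\<close> and
      as \<open>sum z D\<close>; uniqueness of the components makes every scaled vector
      vanish.\<close>
    define u where "u = (\<lambda>U\<in>D. if U \<in> E then scl (c U) (x U) else 0)"
    define z where "z = (\<lambda>U\<in>D. 0 :: 'v)"
    have "u \<in> (\<Pi>\<^sub>E U\<in>D. U)" "z \<in> (\<Pi>\<^sub>E U\<in>D. U)"
      using x E sub by (auto simp: u_def z_def subspace_scale subspace_0)
    moreover have "sum u D = (\<Sum>U\<in>D. if U \<in> E then scl (c U) (x U) else 0)"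
      by (simp add: u_def)
    then have "0 = sum u D"
      using sum0 fin E by (simp add: sum.If_cases Int_absorb1)
    moreover have "0 = sum z D" by (simp add: z_def)
    ultimately have "u = z" using uniq[OF subspace_0[OF W]] by blast
    from fun_cong[OF this, of U] show "c U = 0" using U E x[OF U] by (auto simp: u_def z_def)
  qed
  have inj: "inj_on x E"
  proof (rule inj_onI, rule ccontr)
    fix U V assume UV: "U \<in> E" "V \<in> E" "x U = x V" "U \<noteq> V"
    \<comment> \<open>If two summands shared their chosen vector, the coefficients \<open>1\<close>
      and \<open>-1\<close> would give a nontrivial relation.\<close>
    let ?c = "\<lambda>U'. if U' = U then 1 else if U' = V then -1 else (0::'f)"
    have "(\<Sum>U'\<in>E. scl (?c U') (x U')) = (\<Sum>U'\<in>{U, V}. scl (?c U') (x U'))"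
      using UV finE by (intro sum.mono_neutral_right) auto
    also have "\<dots> = 0" using UV by simp
    finally show False using zero[of ?c U] UV(1) by simp
  qed
  have "independent (x ` E)"
  proof (rule independent_if_scalars_zero)
    fix f v assume "(\<Sum>v\<in>x ` E. scl (f v) v) = 0" "v \<in> x ` E"
    then show "f v = 0" using zero[of "\<lambda>U. f (x U)"] by (auto simp: sum.reindex[OF inj])
  qed (use finE in simp)
  then have "card (x ` E) \<le> card S"
    using independent_span_bound[OF S, of "x ` E"] x by auto
  then show ?thesis using card_image[OF inj] by simp
qed

section \<open>Complete reducibility by averaging\<close>

lemma dim_less_subspace:
  assumes "finite S" "W \<subseteq> span S" "subspace U" "U \<subset> W"
  shows "dim U < dim W"
proof -
  obtain B where B: "B \<subseteq> U" "independent B" "U \<subseteq> span B" "card B = dim U"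
    by (rule basis_exists)
  have "B \<subseteq> W" using B(1) assms(4) by blast
  then obtain C where C: "B \<subseteq> C" "C \<subseteq> W" "independent C" "W \<subseteq> span C"
    using maximal_independent_subset_extend[OF _ B(2)] by metis
  have "finite C" using independent_span_bound[OF assms(1) C(3)] C(2) assms(2) by auto
  moreover have "B \<noteq> C"
    using C(4) B(1) span_minimal[OF _ assms(3)] assms(4) by blast
  ultimately have "card B < card C" using C(1) by (intro psubset_card_mono) auto
  then show ?thesis using B(4) dim_eq_card[of C W] C span_subspace span_eq
    by (metis basis_card_eq_dim)
qed

text \<open>Averaging a linear projection onto \<open>U\<close> over the group gives an equivariant
  map \<open>P\<close> into \<open>U\<close> that is still the identity on \<open>U\<close>; its
  kernel inside \<open>W\<close> is the complement.\<close>

lemma invariant_complement: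
  assumes U: "invariant U" and W: "invariant W" and "U \<subseteq> W"
  obtains V where "invariant V" "V \<subseteq> W" "U \<inter> V = {0}" "\<And>w. w \<in> W \<Longrightarrow> \<exists>u\<in>U. \<exists>v\<in>V. w = u + v"
proof -
  interpret pair: vector_space_pair scl scl ..
  let ?G = "{p. p permutes {1..n}}"
  have subU: "subspace U" and subW: "subspace W" using U W by (auto simp: invariant_def)
  obtain \<pi> where \<pi>: "Vector_Spaces.linear scl scl \<pi>" "\<pi> ` UNIV \<subseteq> U" "\<And>u. u \<in> U \<Longrightarrow> \<pi> u = u"
    using pair.linear_exists_left_inverse_on[OF linear_id subU] by auto
  have finG: "finite ?G" by (simp add: finite_permutations)
  \<comment> \<open>Characteristic \<open>0\<close> enters here: the group order is invertible in
    the field.\<close>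
  have cardG: "(of_nat (card ?G) :: 'f) \<noteq> 0"
    using finG permutes_id[of "{1..n}"] by (metis card_0_eq empty_iff mem_Collect_eq of_nat_eq_0_iff)
  define P where "P = (\<lambda>v. scl (1 / of_nat (card ?G)) (\<Sum>p\<in>?G. \<rho> p (\<pi> (\<rho> (inv' p) v))))"
  have linP: "Vector_Spaces.linear scl scl P"
  proof -
    have "Vector_Spaces.linear scl scl (\<lambda>v. \<rho> p (\<pi> (\<rho> (inv' p) v)))" if "p \<in> ?G" for p
    proof -
      have "Vector_Spaces.linear scl scl (\<rho> p \<circ> (\<pi> \<circ> \<rho> (inv' p)))"
        using that \<pi>(1) by (intro Vector_Spaces.linear_compose[of scl scl _ scl] act_linear permutes_inv) auto
      then show ?thesis by (simp add: o_def)
    qed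
    then show ?thesis unfolding P_def
      by (intro pair.linear_compose_scale_right pair.linear_compose_sum) auto
  qed
  have PU: "P v \<in> U" for v
    unfolding P_def
  proof (intro subspace_scale subspace_sum subU)
    fix p assume "p \<in> ?G"
    moreover have "\<pi> (\<rho> (inv' p) v) \<in> U" using \<pi>(2) by blast
    ultimately show "\<rho> p (\<pi> (\<rho> (inv' p) v)) \<in> U" using U unfolding invariant_def by blast
  qed
  have Pid: "P u = u" if u: "u \<in> U" for u
  proof -
    have "\<rho> p (\<pi> (\<rho> (inv' p) u)) = u" if "p \<in> ?G" for p
    proof -
      have "\<rho> (inv' p) u \<in> U" using that U u permutes_inv[of p] unfolding invariant_def by blast
      then have "\<rho> p (\<pi> (\<rho> (inv' p) u)) = \<rho> (p \<circ> inv' p) u" by (simp add: \<pi>(3) act_comp)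
      then show ?thesis using that permutes_inv_o(1)[of p "{1..n}"] act_id by simp
    qed
    then have "P u = scl (1 / of_nat (card ?G)) (\<Sum>p\<in>?G. u)" unfolding P_def by simp
    also have "\<dots> = u" using cardG by (simp add: sum_constant_scale)
    finally show ?thesis .
  qed
  have Pact: "P (\<rho> q v) = \<rho> q (P v)" if q: "q permutes {1..n}" for q v
  proof -
    interpret lq: Vector_Spaces.linear scl scl "\<rho> q" by (rule act_linear[OF q])
    \<comment> \<open>Reindexing by left multiplication with \<open>q\<close> brings
      \<open>q\<close> to the outside, since
      \<open>inv' (q \<circ> p) \<circ> q = inv' p\<close>.\<close>
    have "(\<Sum>p\<in>?G. \<rho> p (\<pi> (\<rho> (inv' p) (\<rho> q v)))) = (\<Sum>p\<in>?G. \<rho> (q \<circ> p) (\<pi> (\<rho> (inv' (q \<circ> p)) (\<rho> q v))))"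
      by (rule setum_permutations_compose_left[OF q])
    also have "\<dots> = (\<Sum>p\<in>?G. \<rho> q (\<rho> p (\<pi> (\<rho> (inv' p) v))))"
    proof (rule sum.cong)
      fix p assume p: "p \<in> ?G"
      then have "inv' (q \<circ> p) \<circ> q = inv' p"
        using q by (simp add: o_inv_distrib permutes_bij o_assoc[symmetric] permutes_inv_o)
      then have "\<rho> (inv' (q \<circ> p)) (\<rho> q v) = \<rho> (inv' p) v" by (metis act_comp)
      then show "\<rho> (q \<circ> p) (\<pi> (\<rho> (inv' (q \<circ> p)) (\<rho> q v))) = \<rho> q (\<rho> p (\<pi> (\<rho> (inv' p) v)))"
        by (simp add: act_comp)
    qed simp
    finally show ?thesis unfolding P_def by (simp add: lq.scale lq.sum)
  qed
  interpret lP: Vector_Spaces.linear scl scl P by (rule linP)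
  define V where "V = {v \<in> W. P v = 0}"
  show ?thesis
  proof
    have "subspace V"
      unfolding V_def using subW by (auto simp: subspace_def lP.add lP.scale lP.zero)
    then show "invariant V"
      using W Pact pair.linear_0[OF act_linear]
      by (simp add: invariant_def V_def image_subset_iff)
    show "V \<subseteq> W" by (auto simp: V_def)
    show "U \<inter> V = {0}" using Pid subspace_0 subU subW lP.zero by (auto simp: V_def)
    fix w assume "w \<in> W"
    then have "w - P w \<in> V"
      using PU Pid assms(3) subW by (auto simp: V_def lP.diff intro!: subspace_diff)
    then show "\<exists>u\<in>U. \<exists>v\<in>V. w = u + v" using PU by (intro bexI[of _ "P w"] bexI[of _ "w - P w"]) auto
  qed
qed

text \<open>A nonzero invariant subspace of least dimension is irreducible and splits off; induction
  on the dimension treats its complement. The finite set \<open>S\<close> is there because the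
  ambient space may be infinite dimensional, where \<open>dim\<close> alone does not control strict
  inclusions.\<close>

lemma irreducible_decomposition_exists:
  assumes "invariant W" "finite S" "W \<subseteq> span S"
  shows "\<exists>D. irreducible_decomposition n (sn_mod W) D"
  using assms(1,3)
proof (induction "dim W" arbitrary: W rule: less_induct)
  case less
  have subW: "subspace W" using less.prems by (simp add: invariant_def)
  show ?case
  proof (cases "W = {0}")
    case True
    then have "irreducible_decomposition n (sn_mod W) {}"
      unfolding irreducible_decomposition_sn_mod[OF subW] by simp
    then show ?thesis by blast
  next
    case False
    define P where "P = (\<lambda>U. invariant U \<and> U \<subseteq> W \<and> U \<noteq> {0})"
    have "P W" using less.prems False by (auto simp: P_def)
    then obtain U where U: "P U" and min: "\<And>U'. P U' \<Longrightarrow> dim U \<le> dim U'"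
      using ex_has_least_nat[of P W dim] by blast
    have Uinv: "invariant U" and UW: "U \<subseteq> W" and U0: "U \<noteq> {0}" using U by (auto simp: P_def)
    have subU: "subspace U" using Uinv by (simp add: invariant_def)
    have irr: "sn_irreducible n (sn_mod U)"
      unfolding sn_irreducible_sn_mod[OF subU]
    proof (intro conjI allI impI U0)
      fix U' assume U': "invariant U' \<and> U' \<subseteq> U"
      show "U' = {0} \<or> U' = U"
      proof (rule ccontr)
        assume "\<not> ?thesis"
        then have "U' \<subset> U" "P U'" using U' UW by (auto simp: P_def)
        moreover have "subspace U'" using U' by (simp add: invariant_def)
        ultimately have "dim U' < dim U"
          using UW less.prems by (intro dim_less_subspace[OF assms(2)]) auto
        then show False using min[OF \<open>P U'\<close>] by simp
      qed
    qed
    obtain V where V: "invariant V" "V \<subseteq> W" "U \<inter> V = {0}"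
      and UV: "\<And>w. w \<in> W \<Longrightarrow> \<exists>u\<in>U. \<exists>v\<in>V. w = u + v"
      using invariant_complement[OF Uinv less.prems(1) UW] by blast
    have subV: "subspace V" using V by (simp add: invariant_def)
    have "V \<noteq> W" using V UW U0 subspace_0[OF subU] by blast
    then have "dim V < dim W"
      using V(2) subV less.prems by (intro dim_less_subspace[OF assms(2)]) auto
    then obtain D where "irreducible_decomposition n (sn_mod V) D"
      using less.hyps V less.prems by blast
    then have fin: "finite D" and D: "\<And>X. X \<in> D \<Longrightarrow> invariant X \<and> X \<subseteq> V \<and> sn_irreducible n (sn_mod X)"
      and uniq: "\<And>v. v \<in> V \<Longrightarrow> \<exists>!u. u \<in> (\<Pi>\<^sub>E X\<in>D. X) \<and> v = sum u D"
      unfolding irreducible_decomposition_sn_mod[OF subV] by auto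
    \<comment> \<open>A decomposition is a set of submodules, so the new summand must not occur in
      it already.\<close>
    have "U \<notin> D" using D V(3) U0 subspace_0[OF subU] by blast
    have sumV: "sum y D \<in> V" if "y \<in> (\<Pi>\<^sub>E X\<in>D. X)" for y
      using that D by (intro subspace_sum[OF subV]) (auto simp: PiE_iff)
    have "irreducible_decomposition n (sn_mod W) (insert U D)"
      unfolding irreducible_decomposition_sn_mod[OF subW]
    proof (intro conjI ballI)
      fix w assume "w \<in> W"
      then obtain u v where uv: "u \<in> U" "v \<in> V" "w = u + v" using UV by blast
      obtain y where y: "y \<in> (\<Pi>\<^sub>E X\<in>D. X)" "v = sum y D" using uniq[OF uv(2)] by blast
      have sum_upd: "sum (y(U := u)) (insert U D) = u + sum y D" for y u
      proof -
        have "sum (y(U := u)) D = sum y D" by (rule sum.cong) (use \<open>U \<notin> D\<close> in auto)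
        then show ?thesis using fin \<open>U \<notin> D\<close> by simp
      qed
      show "\<exists>!x. x \<in> (\<Pi>\<^sub>E X\<in>insert U D. X) \<and> w = sum x (insert U D)"
      proof (intro ex1I conjI)
        show "y(U := u) \<in> (\<Pi>\<^sub>E X\<in>insert U D. X)" using y(1) uv(1) by (auto simp: PiE_iff extensional_def)
        show "w = sum (y(U := u)) (insert U D)" unfolding sum_upd using uv y by simp
      next
        fix x assume x: "x \<in> (\<Pi>\<^sub>E X\<in>insert U D. X) \<and> w = sum x (insert U D)"
        \<comment> \<open>Resetting the value at \<open>U\<close> gives an extensional family on
          \<open>D\<close>, to which uniqueness in \<open>V\<close> applies.\<close>
        define y' where "y' = x(U := undefined)"
        have y': "y' \<in> (\<Pi>\<^sub>E X\<in>D. X)"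
          using x \<open>U \<notin> D\<close> by (auto simp: y'_def PiE_iff extensional_def)
        have xy': "x = y'(U := x U)" by (simp add: y'_def)
        have xU: "x U \<in> U" using x by auto
        have "u + v = x U + sum y' D" using x sum_upd[of y' "x U", folded xy'] uv(3) by simp
        then have eq: "u - x U = sum y' D - v" by (simp add: algebra_simps)
        have "u - x U \<in> U" using subspace_diff[OF subU uv(1) xU] .
        moreover have "sum y' D - v \<in> V" using subspace_diff[OF subV sumV[OF y'] uv(2)] .
        ultimately have "u - x U \<in> U \<inter> V" using eq by simp
        then have "u - x U = 0" using V(3) by simp
        moreover from this have "sum y' D - v = 0" using eq by simp
        ultimately have "x U = u" "v = sum y' D" by simp_all
        moreover from this have "y' = y" using uniq[OF uv(2)] y y' by blast
        ultimately show "x = y(U := u)" using xy' by simp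
      qed
    qed (use fin D V Uinv UW irr in auto)
    then show ?thesis by blast
  qed
qed

end

section \<open>Young tableaux and Specht modules\<close>

lemma lookup_coeff_scale: "Poly_Mapping.lookup (coeff_scale c f) k = c * Poly_Mapping.lookup f k"
  by (simp add: coeff_scale_def Poly_Mapping.map.rep_eq when_def)

lemma group_algebra_mult_add_left:
  "group_algebra_mult (f + f') g = group_algebra_mult f g + group_algebra_mult f' g"
  unfolding group_algebra_mult_def
  by (rule setsum_keys_plus_distrib)
    (simp_all add: distrib_right single_add sum.distrib)

lemma group_algebra_mult_add_right:
  "group_algebra_mult f (g + g') = group_algebra_mult f g + group_algebra_mult f g'"
  unfolding group_algebra_mult_def sum.distrib[symmetric]
  by (intro sum.cong refl setsum_keys_plus_distrib)
    (simp_all add: distrib_left single_add)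

lemma group_algebra_mult_zero [simp]:
  "group_algebra_mult 0 g = 0" "group_algebra_mult f 0 = 0"
  by (simp_all add: group_algebra_mult_def)

lemma group_algebra_mult_sum_left:
  "group_algebra_mult (sum f I) g = (\<Sum>i\<in>I. group_algebra_mult (f i) g)"
  by (induction I rule: infinite_finite_induct) (simp_all add: group_algebra_mult_add_left)

lemma group_algebra_mult_sum_right:
  "group_algebra_mult f (sum g I) = (\<Sum>i\<in>I. group_algebra_mult f (g i))"
  by (induction I rule: infinite_finite_induct) (simp_all add: group_algebra_mult_add_right)

lemma group_algebra_mult_single:
  "group_algebra_mult (Poly_Mapping.single p a) (Poly_Mapping.single q b) =
    Poly_Mapping.single (p \<circ> q) (a * b)"
  by (cases "a = 0"; cases "b = 0") (simp_all add: group_algebra_mult_def)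

section \<open>Row and column stabilizers as permutation groups\<close>

definition perm_group :: "nat \<Rightarrow> (nat \<Rightarrow> nat) set \<Rightarrow> bool" where
  "perm_group n R \<longleftrightarrow> (\<forall>p\<in>R. p permutes {1..n}) \<and> id \<in> R \<and> (\<forall>p\<in>R. inv' p \<in> R) \<and>
    (\<forall>p\<in>R. \<forall>q\<in>R. p \<circ> q \<in> R)"

lemma finite_perm_group: "perm_group n R \<Longrightarrow> finite R"
  by (rule finite_subset[OF _ finite_permutations[of "{1..n}"]]) (auto simp: perm_group_def)

lemma sum_perm_group_shift:
  assumes R: "perm_group n R" and q: "q \<in> R"
  shows "(\<Sum>p\<in>R. f (q \<circ> p)) = sum f R"
proof -
  have "q permutes {1..n}" "inv' q \<in> R" using R q by (auto simp: perm_group_def)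
  then show ?thesis
    using R q
    by (intro sum.reindex_bij_witness[of R "\<lambda>p. inv' q \<circ> p" "\<lambda>p. q \<circ> p"])
      (auto simp: perm_group_def o_assoc permutes_inv_o)
qed

lemma perm_group_setwise_stabilizer:
  "perm_group n {p \<in> carrier (sym_group n). \<forall>X\<in>F. p ` X = X}"
proof -
  have "inv' p ` X = X" if p: "p permutes {1..n}" "p ` X = X" for p X
  proof -
    have "inv' p ` X = inv' p ` p ` X" using p(2) by simp
    also have "\<dots> = X" using permutes_inj[OF p(1)] by (simp add: image_image)
    finally show ?thesis .
  qed
  moreover have "(p \<circ> q) ` X = X" if "p ` X = X" "q ` X = X" for p q and X :: "nat set"
    using that by (simp only: image_comp[symmetric])
  ultimately show ?thesis
    unfolding perm_group_def
    by (auto simp: sym_group_carrier permutes_id permutes_inv permutes_compose)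
qed

lemma perm_group_row_stabilizer: "perm_group (sum_list \<mu>) (row_stabilizer \<mu>)"
  using perm_group_setwise_stabilizer[of "sum_list \<mu>" "tableau_row \<mu> ` {..<length \<mu>}"]
  by (auto simp: row_stabilizer_def elim!: back_subst[of "perm_group (sum_list \<mu>)"])

lemma perm_group_column_stabilizer: "perm_group (sum_list \<mu>) (column_stabilizer \<mu>)"
  using perm_group_setwise_stabilizer[of "sum_list \<mu>" "tableau_column \<mu> ` {1..}"]
  by (auto simp: column_stabilizer_def elim!: back_subst[of "perm_group (sum_list \<mu>)"])

section \<open>Cells of the tableau filled row by row\<close>

lemma sum_list_take_mono:
  fixes \<mu> :: "nat list"
  shows "i \<le> i' \<Longrightarrow> sum_list (take i \<mu>) \<le> sum_list (take i' \<mu>)"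
  by (auto simp: le_iff_add take_add)

lemma sum_list_take_Suc:
  fixes \<mu> :: "nat list"
  shows "i < length \<mu> \<Longrightarrow> sum_list (take (Suc i) \<mu>) = sum_list (take i \<mu>) + \<mu> ! i"
  by (simp add: take_Suc_conv_app_nth)

lemma tableau_row_iff:
  "k \<in> tableau_row \<mu> i \<longleftrightarrow> sum_list (take i \<mu>) < k \<and> k \<le> sum_list (take i \<mu>) + \<mu> ! i"
proof
  assume "sum_list (take i \<mu>) < k \<and> k \<le> sum_list (take i \<mu>) + \<mu> ! i"
  then show "k \<in> tableau_row \<mu> i"
    unfolding tableau_row_def by (intro CollectI exI[of _ "k - sum_list (take i \<mu>)"]) auto
qed (auto simp: tableau_row_def)

lemma tableau_row_subset:
  assumes "i < length \<mu>"
  shows "tableau_row \<mu> i \<subseteq> {1..sum_list \<mu>}"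
proof
  fix k assume "k \<in> tableau_row \<mu> i"
  moreover have "sum_list (take (Suc i) \<mu>) \<le> sum_list \<mu>"
    using sum_list_take_mono[of "Suc i" "length \<mu>" \<mu>] assms by simp
  ultimately show "k \<in> {1..sum_list \<mu>}"
    using sum_list_take_Suc[OF assms] by (simp add: tableau_row_iff)
qed

lemma tableau_row_unique:
  assumes "k \<in> tableau_row \<mu> i" "k \<in> tableau_row \<mu> i'" "i < length \<mu>" "i' < length \<mu>"
  shows "i = i'"
proof -
  have "\<not> a < b" if "k \<in> tableau_row \<mu> a" "k \<in> tableau_row \<mu> b" "a < length \<mu>" for a b
    using that sum_list_take_mono[of "Suc a" b \<mu>] sum_list_take_Suc[of a \<mu>]
    by (auto simp: tableau_row_iff)
  from this[of i i'] this[of i' i] show ?thesis using assms by auto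
qed

lemma tableau_row_exists:
  assumes "k \<in> {1..sum_list \<mu>}"
  shows "\<exists>i<length \<mu>. k \<in> tableau_row \<mu> i"
proof -
  have "m \<le> length \<mu> \<Longrightarrow> k \<le> sum_list (take m \<mu>) \<Longrightarrow> \<exists>i<m. k \<in> tableau_row \<mu> i" for m
  proof (induction m)
    case (Suc m)
    show ?case
    proof (cases "k \<le> sum_list (take m \<mu>)")
      case True
      then show ?thesis using Suc by (auto intro: less_SucI)
    next
      case False
      then have "k \<in> tableau_row \<mu> m"
        using Suc.prems sum_list_take_Suc[of m \<mu>] by (auto simp: tableau_row_iff)
      then show ?thesis by blast
    qed
  qed (use assms in auto)
  from this[of "length \<mu>"] show ?thesis using assms by simp
qed

lemma tableau_cell_unique:
  fixes \<mu> :: "nat list"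
  assumes eq: "sum_list (take i \<mu>) + j = sum_list (take i' \<mu>) + j'"
    and "i < length \<mu>" "i' < length \<mu>" "1 \<le> j" "1 \<le> j'" "j \<le> \<mu> ! i" "j' \<le> \<mu> ! i'"
  shows "i = i'" "j = j'"
proof -
  have "sum_list (take i \<mu>) + j \<in> tableau_row \<mu> i" "sum_list (take i \<mu>) + j \<in> tableau_row \<mu> i'"
    using assms by (auto simp: tableau_row_iff)
  then show "i = i'" using tableau_row_unique assms(2,3) by blast
  then show "j = j'" using eq by simp
qed

text \<open>The image of an entry stays in the row and in the column of that entry, and these two
  determine the cell. This yields \<open>p = id\<close> when the coefficient at the identity is
  computed below.\<close>

lemma row_column_stabilizer_Int: "row_stabilizer \<mu> \<inter> column_stabilizer \<mu> \<subseteq> {id}"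
proof
  fix p assume p: "p \<in> row_stabilizer \<mu> \<inter> column_stabilizer \<mu>"
  then have perm: "p permutes {1..sum_list \<mu>}" by (simp add: row_stabilizer_def sym_group_carrier)
  have "p k = k" for k
  proof (cases "k \<in> {1..sum_list \<mu>}")
    case True
    then obtain i where i: "i < length \<mu>" "k \<in> tableau_row \<mu> i" using tableau_row_exists by blast
    then obtain j where j: "k = sum_list (take i \<mu>) + j" "1 \<le> j" "j \<le> \<mu> ! i"
      by (auto simp: tableau_row_def)
    have "k \<in> tableau_column \<mu> j" using i j by (auto simp: tableau_column_def)
    then have "p k \<in> tableau_column \<mu> j" using p j(2) unfolding column_stabilizer_def by blast
    then obtain i' where i': "p k = sum_list (take i' \<mu>) + j" "i' < length \<mu>" "j \<le> \<mu> ! i'"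
      by (auto simp: tableau_column_def)
    have "p k \<in> tableau_row \<mu> i" using p i unfolding row_stabilizer_def by blast
    moreover have "p k \<in> tableau_row \<mu> i'" using i' j(2) by (simp add: tableau_row_iff)
    ultimately have "i' = i" using tableau_row_unique i(1) i'(2) by blast
    then show ?thesis using i' j by simp
  qed (use perm in \<open>simp add: permutes_not_in\<close>)
  then show "p \<in> {id}" by auto
qed

text \<open>Parts are positive, so each row meets the first column exactly once. The length of this
  column is what the pigeonhole argument compares with the number of basis elements.\<close>

lemma card_first_column:
  assumes "\<forall>k\<in>set \<mu>. k \<ge> 1"
  shows "card (tableau_column \<mu> 1) = length \<mu>" "tableau_column \<mu> 1 \<subseteq> {1..sum_list \<mu>}"
proof -
  have pos: "1 \<le> \<mu> ! i" if "i < length \<mu>" for i using assms that by simp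
  then have col: "tableau_column \<mu> 1 = (\<lambda>i. sum_list (take i \<mu>) + 1) ` {..<length \<mu>}"
    unfolding tableau_column_def by auto
  have "inj_on (\<lambda>i. sum_list (take i \<mu>) + 1) {..<length \<mu>}"
    using tableau_cell_unique(1)[of _ \<mu> 1 _ 1] pos by (auto intro!: inj_onI)
  then show "card (tableau_column \<mu> 1) = length \<mu>" unfolding col by (simp add: card_image)
  show "tableau_column \<mu> 1 \<subseteq> {1..sum_list \<mu>}"
  proof
    fix k assume "k \<in> tableau_column \<mu> 1"
    then obtain i where "i < length \<mu>" "k \<in> tableau_row \<mu> i"
      using pos by (auto simp: tableau_column_def tableau_row_iff)
    then show "k \<in> {1..sum_list \<mu>}" using tableau_row_subset by blast
  qed
qed

text \<open>Columns are disjoint, so \<open>a\<close> and \<open>b\<close> lie in no other column: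
  the transposition fixes the others pointwise and only permutes the first.\<close>

lemma transpose_in_column_stabilizer:
  assumes pos: "\<forall>k\<in>set \<mu>. k \<ge> 1" and ab: "a \<in> tableau_column \<mu> 1" "b \<in> tableau_column \<mu> 1"
  shows "Transposition.transpose a b \<in> column_stabilizer \<mu>"
proof -
  have "Transposition.transpose a b ` tableau_column \<mu> j = tableau_column \<mu> j" if "j \<ge> 1" for j
  proof (cases "j = 1")
    case False
    have "x \<notin> tableau_column \<mu> j" if x: "x \<in> tableau_column \<mu> 1" for x
    proof
      assume "x \<in> tableau_column \<mu> j"
      then obtain i i' where "x = sum_list (take i \<mu>) + 1" "i < length \<mu>" "1 \<le> \<mu> ! i"
        "x = sum_list (take i' \<mu>) + j" "i' < length \<mu>" "j \<le> \<mu> ! i'"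
        using x by (auto simp: tableau_column_def)
      then show False using tableau_cell_unique(2)[of i \<mu> 1 i' j] \<open>j \<ge> 1\<close> False by simp
    qed
    then show ?thesis using ab by (simp add: transpose_image_eq)
  qed (use ab in \<open>simp add: transpose_image_eq\<close>)
  moreover have "Transposition.transpose a b permutes {1..sum_list \<mu>}"
    using card_first_column(2)[OF pos] ab by (intro permutes_swap_id) auto
  ultimately show ?thesis by (simp add: column_stabilizer_def sym_group_carrier)
qed

section \<open>Symmetric and alternating vectors in the Specht module\<close>

lemma row_stabilizer_fixes_young_symmetrizer:
  assumes "p \<in> row_stabilizer \<mu>"
  shows "group_algebra_mult (Poly_Mapping.single p 1) (young_symmetrizer \<mu>) =
    (young_symmetrizer \<mu> :: _ \<Rightarrow>\<^sub>0 'f::comm_ring_1)"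
  unfolding young_symmetrizer_def
  by (simp add: group_algebra_mult_sum_right group_algebra_mult_single o_assoc
      sum_perm_group_shift[OF perm_group_row_stabilizer assms,
        of "\<lambda>p. \<Sum>q\<in>column_stabilizer \<mu>. Poly_Mapping.single (p \<circ> q) (of_int (sign q))"])

text \<open>The right factor of the Young symmetrizer. Multiplying the symmetrizer by it from the
  left stays in the left ideal and puts a signed column sum in front, on which column permutations
  act by their signs.\<close>

definition column_antisymmetrizer :: "nat list \<Rightarrow> ((nat \<Rightarrow> nat) \<Rightarrow>\<^sub>0 'f::comm_ring_1)" where
  "column_antisymmetrizer \<mu> = (\<Sum>q\<in>column_stabilizer \<mu>. Poly_Mapping.single q (of_int (sign q)))"

lemma column_antisymmetrizer_young_symmetrizer:
  "group_algebra_mult (column_antisymmetrizer \<mu>) (young_symmetrizer \<mu>) =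
    (\<Sum>q'\<in>column_stabilizer \<mu>. \<Sum>p\<in>row_stabilizer \<mu>. \<Sum>q\<in>column_stabilizer \<mu>.
      Poly_Mapping.single (q' \<circ> (p \<circ> q)) (of_int (sign q' * sign q) :: 'f::comm_ring_1))"
  unfolding young_symmetrizer_def column_antisymmetrizer_def group_algebra_mult_sum_left
  by (simp add: group_algebra_mult_sum_right group_algebra_mult_single)

lemma column_stabilizer_sign:
  assumes "q \<in> column_stabilizer \<mu>"
  shows "group_algebra_mult (Poly_Mapping.single q 1)
      (group_algebra_mult (column_antisymmetrizer \<mu>) (young_symmetrizer \<mu>)) =
    coeff_scale (of_int (sign q) :: 'f::comm_ring_1)
      (group_algebra_mult (column_antisymmetrizer \<mu>) (young_symmetrizer \<mu>))"
proof -
  let ?R = "row_stabilizer \<mu>" and ?C = "column_stabilizer \<mu>"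
  \<comment> \<open>The factor \<open>sign q\<close> is absorbed into the summand, since
    \<open>sign r = sign q * sign (q \<circ> r)\<close>; left multiplication by \<open>q\<close> is
    then a mere shift of the summation index.\<close>
  let ?g = "\<lambda>r. \<Sum>p\<in>?R. \<Sum>q'\<in>?C. Poly_Mapping.single (r \<circ> (p \<circ> q')) (of_int (sign q * (sign r * sign q')) :: 'f)"
  have perm: "permutation r" if "r \<in> ?C" for r
    using that sym_group_carrier' by (auto simp: column_stabilizer_def)
  have sgn: "sign q * sign (q \<circ> r) = sign r" if "r \<in> ?C" for r
    using sign_compose[OF perm[OF assms] perm[OF that]] by simp
  have "group_algebra_mult (Poly_Mapping.single q 1)
      (group_algebra_mult (column_antisymmetrizer \<mu>) (young_symmetrizer \<mu>)) = (\<Sum>r\<in>?C. ?g (q \<circ> r))"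
    unfolding column_antisymmetrizer_young_symmetrizer group_algebra_mult_sum_right
      group_algebra_mult_single
    by (intro sum.cong refl) (simp add: o_assoc mult.assoc[symmetric] sgn flip: of_int_mult)
  also have "\<dots> = (\<Sum>r\<in>?C. ?g r)"
    by (rule sum_perm_group_shift[OF perm_group_column_stabilizer assms])
  also have "\<dots> = coeff_scale (of_int (sign q))
      (group_algebra_mult (column_antisymmetrizer \<mu>) (young_symmetrizer \<mu>))"
    unfolding column_antisymmetrizer_young_symmetrizer
    by (intro poly_mapping_eqI)
      (simp add: lookup_sum lookup_coeff_scale lookup_single sum_distrib_left when_def
        if_distrib[of "(*) _"] cong: if_cong)
  finally show ?thesis .
qed

lemma column_antisymmetrizer_young_symmetrizer_nonzero:
  "group_algebra_mult (column_antisymmetrizer \<mu>) (young_symmetrizer \<mu>) \<noteq>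
    (0 :: _ \<Rightarrow>\<^sub>0 'f::{comm_ring_1,ring_char_0})"
    (is "?v \<noteq> 0")
proof -
  let ?R = "row_stabilizer \<mu>" and ?C = "column_stabilizer \<mu>"
  note C = perm_group_column_stabilizer[of \<mu>] and R = perm_group_row_stabilizer[of \<mu>]
  txt \<open>If \<open>q' p q = id\<close>, then \<open>p\<close> lies in both stabilizers, so the coefficient at \<open>id\<close> counts
    the pairs of mutually inverse column permutations.\<close>
  have term_eq: "Poly_Mapping.lookup (Poly_Mapping.single (q' \<circ> (p \<circ> q)) (of_int (sign q' * sign q) :: 'f)) id =
      (if p = id then if q = inv' q' then 1 else 0 else 0)"
    if "q' \<in> ?C" "p \<in> ?R" "q \<in> ?C" for q' p q
  proof -
    have perms: "bij q'" "bij p" "bij q"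
      using that C R by (auto simp: perm_group_def intro: permutes_bij)
    have iff: "q' \<circ> (p \<circ> q) = id \<longleftrightarrow> p = id \<and> q = inv' q'"
    proof
      assume eq: "q' \<circ> (p \<circ> q) = id"
      have "p = inv' q' \<circ> (q' \<circ> (p \<circ> q)) \<circ> inv' q"
        using perms by (simp add: fun_eq_iff bij_is_inj bij_is_surj surj_f_inv_f)
      then have p: "p = inv' q' \<circ> inv' q" using eq by simp
      then have "p \<in> ?C" using that C by (simp add: perm_group_def)
      then have "p = id" using that row_column_stabilizer_Int by blast
      moreover from this have "q' \<circ> q = id" using eq by simp
      then have "q = inv' q'" using perms inv_unique_comp[of q' q]
        by (metis bij_is_inj inv_o_cancel o_assoc comp_id id_comp)
      ultimately show "p = id \<and> q = inv' q'" by simp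
    next
      assume "p = id \<and> q = inv' q'"
      then show "q' \<circ> (p \<circ> q) = id" using perms by (simp add: surj_iff[symmetric] bij_is_surj)
    qed
    have "permutation q'" using that sym_group_carrier' by (auto simp: column_stabilizer_def)
    then have "sign q' * sign (inv' q') = 1" by (simp add: sign_inverse)
    then show ?thesis using iff by (auto simp: lookup_single when_def simp flip: of_int_mult)
  qed
  have "Poly_Mapping.lookup ?v id =
      (\<Sum>q'\<in>?C. \<Sum>p\<in>?R. \<Sum>q\<in>?C. if p = id then if q = inv' q' then 1 else 0 else 0)"
    unfolding column_antisymmetrizer_young_symmetrizer lookup_sum
    by (intro sum.cong refl) (use term_eq in simp)
  also have "\<dots> = (\<Sum>q'\<in>?C. \<Sum>p\<in>?R. if p = id then 1 else 0)"
    by (intro sum.cong refl) (use C finite_perm_group[OF C] in \<open>auto simp: perm_group_def\<close>)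
  also have "\<dots> = of_nat (card ?C)"
    using R finite_perm_group[OF R] by (simp add: perm_group_def)
  \<comment> \<open>All contributions at the identity have sign \<open>+1\<close>, so their number
    survives in characteristic \<open>0\<close>.\<close>
  also have "\<dots> \<noteq> 0"
    using C finite_perm_group[OF C] by (auto simp: perm_group_def)
  finally show ?thesis by auto
qed

lemma specht_module_simps [simp]:
  "u \<oplus>\<^bsub>specht_module \<mu>\<^esub> v = u + v" "c \<odot>\<^bsub>specht_module \<mu>\<^esub> u = coeff_scale c u"
  "act (specht_module \<mu>) p u = group_algebra_mult (Poly_Mapping.single p 1) u"
  by (simp_all add: specht_module_def)

lemma young_symmetrizer_in_specht_module:
  "(young_symmetrizer \<mu> :: _ \<Rightarrow>\<^sub>0 'f::comm_ring_1) \<in> carrier (specht_module \<mu>)"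
proof -
  have "group_algebra_mult (Poly_Mapping.single id 1) (young_symmetrizer \<mu>) =
      (young_symmetrizer \<mu> :: _ \<Rightarrow>\<^sub>0 'f)"
    using perm_group_row_stabilizer[of \<mu>]
    by (intro row_stabilizer_fixes_young_symmetrizer) (simp add: perm_group_def)
  moreover have "Poly_Mapping.single id (1::'f) \<in> group_algebra (sum_list \<mu>)"
    by (simp add: group_algebra_def sym_group_carrier permutes_id)
  ultimately show ?thesis by (simp add: specht_module_def) metis
qed

lemma column_antisymmetrizer_in_specht_module:
  "group_algebra_mult (column_antisymmetrizer \<mu>) (young_symmetrizer \<mu>) \<in>
    carrier (specht_module \<mu> :: ('f::comm_ring_1, _) sn_module)"
proof -
  have "Poly_Mapping.keys (column_antisymmetrizer \<mu> :: _ \<Rightarrow>\<^sub>0 'f) \<subseteq> column_stabilizer \<mu>"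
    unfolding column_antisymmetrizer_def
    by (rule order.trans[OF keys_sum]) (auto split: if_splits)
  then have "(column_antisymmetrizer \<mu> :: _ \<Rightarrow>\<^sub>0 'f) \<in> group_algebra (sum_list \<mu>)"
    by (auto simp: group_algebra_def column_stabilizer_def)
  then show ?thesis by (auto simp: specht_module_def)
qed

text \<open>All relations saying that a permutation acts on \<open>y\<close> by a scalar are pulled
  back together. One statement thus serves the row-invariant vector, with scalar \<open>1\<close>,
  and the column-alternating one, with the sign as scalar.\<close>

lemma stable_vector_of_specht_iso:
  fixes M :: "('f::field_char_0, 'v) sn_module"
  assumes M: "abelian_group M" and U: "sn_submodule n M U"
    and iso: "sn_isomorphic n (M\<lparr>carrier := U\<rparr>) (specht_module \<mu>)"
    and y: "y \<in> carrier (specht_module \<mu>)" "y \<noteq> 0"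
  obtains u where "u \<in> U" "u \<noteq> \<zero>\<^bsub>M\<^esub>"
    "\<And>p c. p \<in> carrier (sym_group n) \<Longrightarrow>
      group_algebra_mult (Poly_Mapping.single p 1) y = coeff_scale c y \<Longrightarrow> act M p u = c \<odot>\<^bsub>M\<^esub> u"
proof -
  interpret M: abelian_group M by fact
  obtain \<phi> where bij: "bij_betw \<phi> U (carrier (specht_module \<mu>))"
    and add: "\<And>u v. u \<in> U \<Longrightarrow> v \<in> U \<Longrightarrow> \<phi> (u \<oplus>\<^bsub>M\<^esub> v) = \<phi> u + \<phi> v"
    and smult: "\<And>c u. u \<in> U \<Longrightarrow> \<phi> (c \<odot>\<^bsub>M\<^esub> u) = coeff_scale c (\<phi> u)"
    and act: "\<And>p u. p \<in> carrier (sym_group n) \<Longrightarrow> u \<in> U \<Longrightarrow>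
      \<phi> (act M p u) = group_algebra_mult (Poly_Mapping.single p 1) (\<phi> u)"
    using iso unfolding sn_isomorphic_def by auto
  have zero: "\<zero>\<^bsub>M\<^esub> \<in> U" using U subgroup.one_closed[of U "add_monoid M"] by (simp add: sn_submodule_def)
  have "\<phi> \<zero>\<^bsub>M\<^esub> = \<phi> \<zero>\<^bsub>M\<^esub> + \<phi> \<zero>\<^bsub>M\<^esub>" using add[OF zero zero] by simp
  then have \<phi>0: "\<phi> \<zero>\<^bsub>M\<^esub> = 0" by simp
  obtain u where u: "u \<in> U" "\<phi> u = y"
    using bij y(1) unfolding bij_betw_def by (metis imageE)
  show ?thesis
  proof
    show "u \<in> U" by fact
    show "u \<noteq> \<zero>\<^bsub>M\<^esub>" using u y(2) \<phi>0 by auto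
    fix p c
    assume p: "p \<in> carrier (sym_group n)"
      and "group_algebra_mult (Poly_Mapping.single p 1) y = coeff_scale c y"
    then have "\<phi> (act M p u) = \<phi> (c \<odot>\<^bsub>M\<^esub> u)" using act smult u by simp
    moreover have "act M p u \<in> U" "c \<odot>\<^bsub>M\<^esub> u \<in> U" using U u p by (auto simp: sn_submodule_def)
    ultimately show "act M p u = c \<odot>\<^bsub>M\<^esub> u" using bij by (auto simp: bij_betw_def dest: inj_onD)
  qed
qed

section \<open>Multiplicities in spaces of multilinear forms\<close>

definition fun_scale :: "'f::field \<Rightarrow> ('k \<Rightarrow> 'f) \<Rightarrow> 'k \<Rightarrow> 'f" where
  "fun_scale c F = (\<lambda>k. c * F k)"

text \<open>Precomposition is a right action on tuples; pulling functions back along it gives a left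
  action, the one that matches the renaming of variables.\<close>

definition place_act :: "(nat \<Rightarrow> nat) \<Rightarrow> ((nat \<Rightarrow> 'b) \<times> 'b \<Rightarrow> 'f) \<Rightarrow> (nat \<Rightarrow> 'b) \<times> 'b \<Rightarrow> 'f" where
  "place_act p F = (\<lambda>(b, c). F (b \<circ> p, c))"

interpretation fun_space: vector_space "fun_scale :: 'f::field \<Rightarrow> ('k \<Rightarrow> 'f) \<Rightarrow> 'k \<Rightarrow> 'f"
  by unfold_locales (auto simp: fun_scale_def fun_eq_iff algebra_simps)

interpretation place: linear_sn_action
  "fun_scale :: 'f::field_char_0 \<Rightarrow> ((nat \<Rightarrow> 'b) \<times> 'b \<Rightarrow> 'f) \<Rightarrow> (nat \<Rightarrow> 'b) \<times> 'b \<Rightarrow> 'f" n place_act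
  for n
  by unfold_locales
    (auto simp: place_act_def fun_scale_def fun_eq_iff o_assoc Vector_Spaces.linear_iff
      fun_space.vector_space_axioms)

lemma sum_fun_apply: "sum f I k = (\<Sum>i\<in>I. f i k)" for f :: "'i \<Rightarrow> 'k \<Rightarrow> 'f::comm_monoid_add"
  by (induction I rule: infinite_finite_induct) auto

text \<open>The coefficients are the values of \<open>F\<close> at representatives of the fibres of
  \<open>st\<close>. Coarse choices of \<open>st\<close> give small spanning sets.\<close>

lemma in_span_fibre_indicators:
  fixes F :: "'k \<Rightarrow> 'f::field"
  assumes K: "finite K" and supp: "\<And>k. k \<notin> K \<Longrightarrow> F k = 0"
    and const: "\<And>k k'. k \<in> K \<Longrightarrow> k' \<in> K \<Longrightarrow> st k = st k' \<Longrightarrow> F k = F k'"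
  shows "F \<in> fun_space.span ((\<lambda>z k. if k \<in> K \<and> st k = z then 1 else 0) ` st ` K)"
proof -
  let ?e = "\<lambda>z k. if k \<in> K \<and> st k = z then 1 else (0::'f)"
  let ?g = "\<lambda>z. F (inv_into K st z)"
  have "F = (\<Sum>z\<in>st ` K. fun_scale (?g z) (?e z))"
  proof
    fix k
    have "(\<Sum>z\<in>st ` K. fun_scale (?g z) (?e z)) k = (\<Sum>z\<in>st ` K. if k \<in> K \<and> st k = z then ?g z else 0)"
      unfolding sum_fun_apply by (intro sum.cong refl) (simp add: fun_scale_def)
    also have "\<dots> = (if k \<in> K then ?g (st k) else 0)" using K by auto
    also have "\<dots> = F k"
      using supp const[of "inv_into K st (st k)" k] by (auto simp: inv_into_into f_inv_into_f)
    finally show "F k = (\<Sum>z\<in>st ` K. fun_scale (?g z) (?e z)) k" by simp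
  qed
  also have "\<dots> \<in> fun_space.span (?e ` st ` K)"
    by (intro fun_space.span_sum fun_space.span_scale fun_space.span_base) blast
  finally show ?thesis .
qed

text \<open>The pair \<open>(b, c)\<close> indexes the coordinate \<open>c\<close> of the value at the basis tuple \<open>b\<close>.\<close>

definition tuples :: "nat \<Rightarrow> 'b set \<Rightarrow> ((nat \<Rightarrow> 'b) \<times> 'b) set" where
  "tuples n B = ({1..n} \<rightarrow>\<^sub>E B) \<times> B"

lemma finite_tuples: "finite B \<Longrightarrow> finite (tuples n B)"
  by (auto simp: tuples_def finite_PiE)

text \<open>Tuples in which each basis element occurs equally often in each row differ by a
  permutation preserving \<open>r\<close>, so an invariant function does not distinguish them. There
  are \<open>m * card B\<close> such counts, each between \<open>0\<close> and \<open>n\<close>; the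
  output coordinate contributes the other factor \<open>card B\<close>.\<close>

lemma row_invariants_span:
  fixes B :: "'b set" and r :: "nat \<Rightarrow> nat"
  assumes B: "finite B" and r: "\<And>k. k \<in> {1..n} \<Longrightarrow> r k < m"
  obtains S :: "((nat \<Rightarrow> 'b) \<times> 'b \<Rightarrow> 'f::field_char_0) set"
  where "finite S" "card S \<le> card B * (n + 1) ^ (m * card B)"
    "{F. (\<forall>k. k \<notin> tuples n B \<longrightarrow> F k = 0) \<and>
      (\<forall>p. p permutes {1..n} \<longrightarrow> (\<forall>k\<in>{1..n}. r (p k) = r k) \<longrightarrow> place_act p F = F)}
      \<subseteq> fun_space.span S"
proof -
  define cnt where
    "cnt = (\<lambda>b. \<lambda>(i, a)\<in>{..<m} \<times> B. card {k \<in> {1..n}. r k = i \<and> b k = (a :: 'b)})"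
  define st where "st = (\<lambda>(b, c :: 'b). (cnt b, c))"
  let ?K = "tuples n B"
  let ?S = "(\<lambda>z k. if k \<in> ?K \<and> st k = z then 1 else 0) ` st ` ?K :: ((nat \<Rightarrow> 'b) \<times> 'b \<Rightarrow> 'f) set"
  let ?Z = "({..<m} \<times> B \<rightarrow>\<^sub>E {0..n}) \<times> B"
  have finZ: "finite ?Z" using B by (auto intro!: finite_PiE)
  have le: "card {k \<in> {1..n}. P k} \<le> n" for P
    by (rule order.trans[OF card_mono[of "{1..n}"]]) auto
  have stK: "st ` ?K \<subseteq> ?Z" using le by (auto simp: st_def cnt_def tuples_def split: if_splits)
  then have "card ?S \<le> card ?Z"
    using finZ by (meson card_image_le card_mono finite_subset order.trans)
  also have "\<dots> = card B * (n + 1) ^ (m * card B)"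
    using B by (simp add: card_cartesian_product card_PiE)
  finally have card: "card ?S \<le> card B * (n + 1) ^ (m * card B)" .
  have span: "F \<in> fun_space.span ?S"
    if supp: "\<And>k. k \<notin> ?K \<Longrightarrow> F k = 0"
      and inv: "\<And>p. p permutes {1..n} \<Longrightarrow> (\<forall>k\<in>{1..n}. r (p k) = r k) \<Longrightarrow> place_act p F = F"
    for F :: "(nat \<Rightarrow> 'b) \<times> 'b \<Rightarrow> 'f"
  proof (rule in_span_fibre_indicators)
    show "finite ?K" by (rule finite_tuples[OF B])
    show "F k = 0" if "k \<notin> ?K" for k using supp that .
    fix k k' assume k: "k \<in> ?K" and k': "k' \<in> ?K" and eq: "st k = st k'"
    obtain b b' c where bc: "k = (b, c)" "k' = (b', c)" and cnt: "cnt b = cnt b'"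
      using eq by (cases k; cases k') (auto simp: st_def)
    have bB: "b \<in> {1..n} \<rightarrow>\<^sub>E B" "b' \<in> {1..n} \<rightarrow>\<^sub>E B" using k k' bc by (auto simp: tuples_def)
    \<comment> \<open>Pairs outside \<open>{..<m} \<times> B\<close> never occur, so
      \<open>cnt\<close> determines how often every pair occurs.\<close>
    have "card {x \<in> {1..n}. (r x, b x) = z} = card {x \<in> {1..n}. (r x, b' x) = z}" for z
    proof (cases "z \<in> {..<m} \<times> B")
      case True
      then show ?thesis using fun_cong[OF cnt, of z] by (auto simp: cnt_def)
    next
      case False
      then have none: "(r x, b x) \<noteq> z" "(r x, b' x) \<noteq> z" if "x \<in> {1..n}" for x
        using that bB r by (auto simp: PiE_iff)
      have "{x \<in> {1..n}. (r x, b x) = z} = {}" "{x \<in> {1..n}. (r x, b' x) = z} = {}"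
        using none by blast+
      then show ?thesis by (simp only:)
    qed
    \<comment> \<open>Working with pairs makes the resulting permutation match the tuples and
      preserve \<open>r\<close> at the same time.\<close>
    then have "image_mset (\<lambda>x. (r x, b x)) (mset_set {1..n}) = image_mset (\<lambda>x. (r x, b' x)) (mset_set {1..n})"
      by (intro multiset_eqI) (simp only: count_image_mset_eq_card_vimage[OF finite_atLeastAtMost])
    then obtain p where p: "p permutes {1..n}" "\<forall>x\<in>{1..n}. (r x, b x) = (r (p x), b' (p x))"
      by (rule image_mset_eq_implies_permutes[OF finite_atLeastAtMost])
    \<comment> \<open>Outside \<open>{1..n}\<close> both tuples are \<open>undefined\<close> and
      \<open>p\<close> is the identity, so the functions agree everywhere.\<close>
    have "b = b' \<circ> p"
    proof
      fix x
      show "b x = (b' \<circ> p) x"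
        using p bB by (cases "x \<in> {1..n}") (auto simp: PiE_iff extensional_def permutes_not_in)
    qed
    moreover have "place_act p F = F" using inv p by auto
    from fun_cong[OF this, of "(b', c)"] have "F (b' \<circ> p, c) = F (b', c)" by (simp add: place_act_def)
    ultimately show "F k = F k'" using bc by simp
  qed
  show ?thesis
  proof (rule that[OF _ card])
    show "finite ?S" using finite_subset[OF stK finZ] by simp
  qed (auto intro: span)
qed

lemma specht_multiplicity_bound:
  fixes B :: "'b set" and W :: "((nat \<Rightarrow> 'b) \<times> 'b \<Rightarrow> 'f::field_char_0) set"
  assumes B: "finite B" and W: "fun_space.subspace W"
    and supp: "\<And>F k. F \<in> W \<Longrightarrow> k \<notin> tuples n B \<Longrightarrow> F k = 0"
    and dec: "irreducible_decomposition n (place.sn_mod W) D"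
    and \<mu>: "\<mu> \<in> partitions n"
  shows "card {U \<in> D. sn_isomorphic n (place.sn_mod U) (specht_module \<mu>)} \<le>
    (if length \<mu> \<le> card B then card B * (n + 1) ^ (card B)\<^sup>2 else 0)"
proof -
  have n: "sum_list \<mu> = n" and pos: "\<forall>k\<in>set \<mu>. k \<ge> 1" using \<mu> by (auto simp: partitions_def)
  let ?E = "{U \<in> D. sn_isomorphic n (place.sn_mod U) (specht_module \<mu>)}"
  note M = place.abelian_group_sn_mod[OF W]
  have sub: "sn_submodule n (place.sn_mod W) U" "U \<subseteq> W" if "U \<in> D" for U
    using dec that unfolding place.irreducible_decomposition_sn_mod[OF W] place.sn_submodule_sn_mod[OF W]
    by auto
  have stable: "\<exists>u\<in>U. u \<noteq> 0 \<and> (\<forall>p c. p permutes {1..n} \<longrightarrow>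
      group_algebra_mult (Poly_Mapping.single p 1) y = coeff_scale c y \<longrightarrow> place_act p u = fun_scale c u)"
    if asm: "U \<in> ?E" "y \<in> carrier (specht_module \<mu>)" "y \<noteq> 0" for y :: "(nat \<Rightarrow> nat) \<Rightarrow>\<^sub>0 'f" and U
  proof -
    obtain u where "u \<in> U" "u \<noteq> \<zero>\<^bsub>place.sn_mod W\<^esub>"
      "\<And>p c. p \<in> carrier (sym_group n) \<Longrightarrow>
        group_algebra_mult (Poly_Mapping.single p 1) y = coeff_scale c y \<Longrightarrow>
        act (place.sn_mod W) p u = c \<odot>\<^bsub>place.sn_mod W\<^esub> u"
      by (rule stable_vector_of_specht_iso[OF M sub(1), of U \<mu> y]) (use asm in auto)
    then show ?thesis by (auto simp: sym_group_carrier)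
  qed
  let ?y = "young_symmetrizer \<mu> :: _ \<Rightarrow>\<^sub>0 'f" and ?c = "column_antisymmetrizer \<mu> :: _ \<Rightarrow>\<^sub>0 'f"
  have cy0: "group_algebra_mult ?c ?y \<noteq> 0" by (rule column_antisymmetrizer_young_symmetrizer_nonzero)
  then have y0: "?y \<noteq> 0" by auto
  have bound: "card ?E \<le> card B * (n + 1) ^ (card B)\<^sup>2" if len: "length \<mu> \<le> card B"
  proof -
    \<comment> \<open>The row index becomes a function \<open>r\<close>, so that permutations
      preserving \<open>r\<close> lie in the row stabilizer.\<close>
    have "\<forall>k\<in>{1..n}. \<exists>i<length \<mu>. k \<in> tableau_row \<mu> i" using tableau_row_exists n by blast
    then obtain r where r: "\<And>k. k \<in> {1..n} \<Longrightarrow> r k < length \<mu> \<and> k \<in> tableau_row \<mu> (r k)"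
      by metis
    have stab: "p \<in> row_stabilizer \<mu>" if p: "p permutes {1..n}" "\<forall>k\<in>{1..n}. r (p k) = r k" for p
    proof -
      have row: "tableau_row \<mu> i = {k \<in> {1..n}. r k = i}" if "i < length \<mu>" for i
      proof (intro equalityI subsetI)
        fix k assume k: "k \<in> tableau_row \<mu> i"
        then have "k \<in> {1..n}" using tableau_row_subset[OF that] n by blast
        then show "k \<in> {k \<in> {1..n}. r k = i}"
          using r tableau_row_unique[OF _ k _ that] by blast
      qed (use r in blast)
      have "p ` tableau_row \<mu> i = tableau_row \<mu> i" if i: "i < length \<mu>" for i
      proof (rule endo_inj_surj)
        show "finite (tableau_row \<mu> i)" using row[OF i] by simp
        show "p ` tableau_row \<mu> i \<subseteq> tableau_row \<mu> i"
          using row[OF i] p permutes_in_image[OF p(1)] by auto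
        show "inj_on p (tableau_row \<mu> i)" using permutes_inj_on[OF p(1)] .
      qed
      then show ?thesis using p(1) n by (simp add: row_stabilizer_def sym_group_carrier)
    qed
    have r_less: "r k < length \<mu>" if "k \<in> {1..n}" for k using r that by blast
    obtain S :: "((nat \<Rightarrow> 'b) \<times> 'b \<Rightarrow> 'f) set"
      where S: "finite S" "card S \<le> card B * (n + 1) ^ (length \<mu> * card B)"
        "{F. (\<forall>k. k \<notin> tuples n B \<longrightarrow> F k = 0) \<and>
          (\<forall>p. p permutes {1..n} \<longrightarrow> (\<forall>k\<in>{1..n}. r (p k) = r k) \<longrightarrow> place_act p F = F)}
          \<subseteq> fun_space.span S"
      by (rule row_invariants_span[OF B r_less])
    have "\<exists>u. u \<in> U \<and> u \<noteq> 0 \<and> u \<in> fun_space.span S" if U: "U \<in> ?E" for U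
    proof -
      obtain u where u: "u \<in> U" "u \<noteq> 0" and act: "\<And>p c. p permutes {1..n} \<Longrightarrow>
          group_algebra_mult (Poly_Mapping.single p 1) ?y = coeff_scale c ?y \<Longrightarrow> place_act p u = fun_scale c u"
        using stable[OF U young_symmetrizer_in_specht_module y0] by blast
      have "u \<in> fun_space.span S"
      proof (rule subsetD[OF S(3)], intro CollectI conjI allI impI)
        show "u k = 0" if "k \<notin> tuples n B" for k
          using u sub(2) supp U that by blast
      next
        fix p assume p: "p permutes {1..n}" "\<forall>k\<in>{1..n}. r (p k) = r k"
        have "coeff_scale 1 ?y = ?y" by (intro poly_mapping_eqI) (simp add: lookup_coeff_scale)
        then have "place_act p u = fun_scale 1 u"
          by (intro act p(1)) (simp add: row_stabilizer_fixes_young_symmetrizer[OF stab[OF p]])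
        then show "place_act p u = u" by (simp add: fun_scale_def)
      qed
      then show ?thesis using u by blast
    qed
    then have "\<forall>U\<in>?E. \<exists>u. u \<in> U \<and> u \<noteq> 0 \<and> u \<in> fun_space.span S" by (rule ballI)
    from bchoice[OF this] obtain x
      where x: "\<forall>U\<in>?E. x U \<in> U \<and> x U \<noteq> 0 \<and> x U \<in> fun_space.span S" by (rule exE)
    have "card ?E \<le> card S"
      by (rule place.card_le_if_independent_summands[OF W dec _ bspec[OF x] S(1)]) simp_all
    \<comment> \<open>Here \<open>length \<mu> \<le> card B\<close> turns the exponent
      \<open>length \<mu> * card B\<close> into a square.\<close>
    also have "\<dots> \<le> card B * (n + 1) ^ (card B)\<^sup>2"
      using S(2) len by (elim order.trans) (auto simp: power2_eq_square intro!: power_increasing)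
    finally show ?thesis .
  qed
  have empty: "?E = {}" if len: "\<not> length \<mu> \<le> card B"
  proof (rule ccontr)
    assume "?E \<noteq> {}"
    then obtain U where U: "U \<in> ?E" by blast
    obtain v where v: "v \<in> U" "v \<noteq> 0" and act: "\<And>p c. p permutes {1..n} \<Longrightarrow>
        group_algebra_mult (Poly_Mapping.single p 1) (group_algebra_mult ?c ?y) =
          coeff_scale c (group_algebra_mult ?c ?y) \<Longrightarrow> place_act p v = fun_scale c v"
      using stable[OF U column_antisymmetrizer_in_specht_module cy0] by blast
    have sgn: "place_act q v = fun_scale (of_int (sign q)) v" if q: "q \<in> column_stabilizer \<mu>" for q
      by (rule act[OF _ column_stabilizer_sign[OF q]])
        (use q n in \<open>simp add: column_stabilizer_def sym_group_carrier\<close>)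
    have "v k = 0" for k
    proof (cases "k \<in> tuples n B")
      case True
      then obtain b c where k: "k = (b, c)" "b \<in> {1..n} \<rightarrow>\<^sub>E B" by (auto simp: tuples_def)
      let ?C = "tableau_column \<mu> 1"
      \<comment> \<open>The first column has more cells than there are basis elements, so two
        entries of the tuple in it coincide. Transposing their places fixes the tuple but negates
        \<open>v\<close>, which forces the value \<open>0\<close> in characteristic
        \<open>0\<close>.\<close>
      have "b ` ?C \<subseteq> B" using k(2) card_first_column(2)[OF pos] n by (auto simp: PiE_iff)
      then have "card (b ` ?C) < card ?C"
        using card_mono[OF B, of "b ` ?C"] len card_first_column(1)[OF pos] by simp
      then have "\<not> inj_on b ?C" by (rule pigeonhole)
      then obtain i j where ij: "i \<in> ?C" "j \<in> ?C" "i \<noteq> j" "b i = b j" by (auto simp: inj_on_def)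
      let ?t = "Transposition.transpose i j"
      have "b \<circ> ?t = b" using ij(4) by (auto simp: fun_eq_iff Transposition.transpose_def)
      then have "place_act ?t v k = v k" by (simp add: place_act_def k)
      moreover have "place_act ?t v k = - v k"
        using sgn[OF transpose_in_column_stabilizer[OF pos ij(1,2)]] ij(3)
        by (simp add: fun_scale_def sign_swap_id)
      ultimately show ?thesis by simp
    next
      case False
      then show ?thesis using supp sub(2) U v(1) by blast
    qed
    then show False using v(2) by (auto simp: fun_eq_iff)
  qed
  show ?thesis
  proof (cases "length \<mu> \<le> card B")
    case True
    then show ?thesis using bound by simp
  next
    case False
    show ?thesis unfolding empty[OF False] by simp
  qed
qed

text \<open>Pad with zeros to \<open>d\<close> entries, each at most \<open>n\<close>. Parts are
  positive, so the padding can be told from the parts and the map is injective.\<close>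

lemma card_partitions_le:
  "card {\<mu> \<in> partitions n. length \<mu> \<le> d} \<le> (n + 1) ^ d"
proof -
  let ?P = "{\<mu> \<in> partitions n. length \<mu> \<le> d}"
  let ?f = "\<lambda>\<mu>. \<lambda>i\<in>{..<d}. if i < length \<mu> then \<mu> ! i else (0::nat)"
  have inj: "inj_on ?f ?P"
  proof (rule inj_onI)
    fix \<mu> \<nu> assume \<mu>: "\<mu> \<in> ?P" and \<nu>: "\<nu> \<in> ?P" and eq: "?f \<mu> = ?f \<nu>"
    have entry: "(if i < length \<mu> then \<mu> ! i else 0) = (if i < length \<nu> then \<nu> ! i else 0)" if "i < d" for i
      using fun_cong[OF eq, of i] that by simp
    have pos: "\<mu> ! i > 0" if "i < length \<mu>" "\<mu> \<in> ?P" for i \<mu>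
      using that by (auto simp: partitions_def Suc_le_eq)
    have iff: "i < length \<mu> \<longleftrightarrow> i < length \<nu>" if "i < d" for i
      using entry[OF that] pos[of i \<mu>] pos[of i \<nu>] \<mu> \<nu> by (auto split: if_splits)
    have le: "length \<mu> \<le> d" "length \<nu> \<le> d" using \<mu> \<nu> by auto
    have "length \<mu> = length \<nu>"
      using iff[of "length \<mu>"] iff[of "length \<nu>"] le by (cases "length \<mu>" "length \<nu>" rule: linorder_cases) auto
    then show "\<mu> = \<nu>"
    proof (rule nth_equalityI)
      fix i assume "i < length \<mu>"
      then show "\<mu> ! i = \<nu> ! i" using entry[of i] le \<open>length \<mu> = length \<nu>\<close> by simp
    qed
  qed
  have "?f \<mu> \<in> {..<d} \<rightarrow>\<^sub>E {0..n}" if "\<mu> \<in> ?P" for \<mu>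
    using that elem_le_sum_list by (auto simp: partitions_def)
  then have sub: "?f ` ?P \<subseteq> {..<d} \<rightarrow>\<^sub>E {0..n}" by blast
  have fin: "finite ({..<d} \<rightarrow>\<^sub>E {0..n})" by (simp add: finite_PiE)
  show "card ?P \<le> (n + 1) ^ d"
    using card_inj_on_le[OF inj sub fin] by (simp add: card_PiE)
qed

section \<open>Substitutions of homogeneous components\<close>

lemma coeff_scale_keys: "Poly_Mapping.keys (coeff_scale c f) \<subseteq> Poly_Mapping.keys f"
  by (auto simp: in_keys_iff lookup_coeff_scale)

lemma multilinear_polys_add:
  "f \<in> multilinear_polys n T \<Longrightarrow> g \<in> multilinear_polys n T \<Longrightarrow> f + g \<in> multilinear_polys n T"
  using Poly_Mapping.keys_add[of f g] by (auto simp: multilinear_polys_def)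

lemma multilinear_polys_scale: "f \<in> multilinear_polys n T \<Longrightarrow> coeff_scale c f \<in> multilinear_polys n T"
  using coeff_scale_keys[of c f] by (auto simp: multilinear_polys_def)

lemma letters_map_word: "letters (map_word h w) = map h (letters w)"
  by (induction w) auto

text \<open>What evaluation uses of a multilinear word: each lower index occurs exactly once, while
  nothing ties its degree to the degree it has in another word.\<close>

lemma multilinear_word_letters:
  assumes "w \<in> multilinear_words n T"
  shows "distinct (map fst (letters w))" "fst ` set (letters w) = {1..n}" "snd ` set (letters w) \<subseteq> T"
proof -
  obtain p t where p: "p permutes {1..n}" and t: "t \<in> {1..n} \<rightarrow> T"
    and w: "letters w = map (\<lambda>j. (p j, t j)) [1..<n + 1]"
    using assms by (auto simp: multilinear_words_def sym_group_carrier)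
  have set: "set [1..<n + 1] = {1..n}" by auto
  have "map fst (letters w) = map p [1..<n + 1]" by (simp add: w)
  then show "distinct (map fst (letters w))"
    by (metis distinct_map distinct_upt permutes_inj_on[OF p])
  have "fst ` set (letters w) = p ` {1..n}" unfolding w set_map set by (simp add: image_image)
  then show "fst ` set (letters w) = {1..n}" using permutes_image[OF p] by simp
  show "snd ` set (letters w) \<subseteq> T" unfolding w set_map set using t by auto
qed

lemma rename_word_multilinear:
  assumes "w \<in> multilinear_words n T" "p permutes {1..n}"
  shows "map_word (\<lambda>(i, t). (p i, t)) w \<in> multilinear_words n T"
proof -
  obtain q t where q: "q permutes {1..n}" and t: "t \<in> {1..n} \<rightarrow> T"
    and w: "letters w = map (\<lambda>j. (q j, t j)) [1..<n + 1]"
    using assms(1) by (auto simp: multilinear_words_def sym_group_carrier)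
  have "letters (map_word (\<lambda>(i, t). (p i, t)) w) = map (\<lambda>j. ((p \<circ> q) j, t j)) [1..<n + 1]"
    by (simp add: letters_map_word w)
  then show ?thesis
    unfolding multilinear_words_def
    by (intro CollectI bexI[of _ "p \<circ> q"] bexI[of _ t])
      (use permutes_compose[OF q assms(2)] t in \<open>auto simp: sym_group_carrier\<close>)
qed

lemma rename_poly_multilinear:
  assumes "f \<in> multilinear_polys n T" "p permutes {1..n}"
  shows "rename_poly p f \<in> multilinear_polys n T"
proof -
  have "Poly_Mapping.keys (rename_poly p f) \<subseteq>
      (\<Union>w\<in>Poly_Mapping.keys f. {map_word (\<lambda>(i, t). (p i, t)) w})"
    unfolding rename_poly_def by (rule order.trans[OF keys_sum]) (auto split: if_splits)
  then show ?thesis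
    using assms rename_word_multilinear unfolding multilinear_polys_def by blast
qed

section \<open>Evaluation of non-associative polynomials\<close>

lemma eval_word_cong:
  "(\<And>x. x \<in> set (letters w) \<Longrightarrow> \<psi> x = \<psi>' x) \<Longrightarrow> eval_word mul \<psi> w = eval_word mul \<psi>' w"
  by (induction w) auto

lemma eval_word_map_word: "eval_word mul \<psi> (map_word h w) = eval_word mul (\<psi> \<circ> h) w"
  by (induction w) auto

context nonassoc_algebra
begin

lemma eval_poly_add:
  "eval_poly scale mul \<psi> (f + g) = eval_poly scale mul \<psi> f + eval_poly scale mul \<psi> g"
  unfolding eval_poly_def
  by (rule setsum_keys_plus_distrib) (simp_all add: scale_left_distrib)

lemma eval_poly_scale:
  "eval_poly scale mul \<psi> (coeff_scale c f) = scale c (eval_poly scale mul \<psi> f)"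
proof -
  have "eval_poly scale mul \<psi> (coeff_scale c f) =
      (\<Sum>w\<in>Poly_Mapping.keys f. scale (Poly_Mapping.lookup (coeff_scale c f) w) (eval_word mul \<psi> w))"
    unfolding eval_poly_def
    by (rule sum.mono_neutral_left) (use coeff_scale_keys[of c f] in \<open>auto simp: in_keys_iff\<close>)
  then show ?thesis by (simp add: eval_poly_def lookup_coeff_scale scale_sum_right)
qed

lemma eval_poly_single: "eval_poly scale mul \<psi> (Poly_Mapping.single w c) = scale c (eval_word mul \<psi> w)"
  by (cases "c = 0") (simp_all add: eval_poly_def)

lemma eval_poly_sum:
  "eval_poly scale mul \<psi> (sum f I) = (\<Sum>i\<in>I. eval_poly scale mul \<psi> (f i))"
  by (induction I rule: infinite_finite_induct) (simp_all add: eval_poly_add, simp_all add: eval_poly_def)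

lemma eval_poly_rename:
  "eval_poly scale mul \<psi> (rename_poly p f) = eval_poly scale mul (\<psi> \<circ> (\<lambda>(i, t). (p i, t))) f"
  by (simp add: rename_poly_def eval_poly_sum eval_poly_single eval_word_map_word)
    (simp add: eval_poly_def)

end

section \<open>Homogeneous components and multilinearity of evaluation\<close>

context graded_algebra
begin

sublocale self_pair: vector_space_pair scale scale ..

definition is_decomposition :: "'a \<Rightarrow> ('t \<Rightarrow>\<^sub>0 'a) \<Rightarrow> bool" where
  "is_decomposition a c \<longleftrightarrow> Poly_Mapping.keys c \<subseteq> T \<and> (\<forall>t\<in>T. Poly_Mapping.lookup c t \<in> A t) \<and>
    a = (\<Sum>t\<in>Poly_Mapping.keys c. Poly_Mapping.lookup c t)"

definition component :: "'a \<Rightarrow> 't \<Rightarrow> 'a" where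
  "component a = Poly_Mapping.lookup (THE c. is_decomposition a c)"

lemma component_eq: "is_decomposition a c \<Longrightarrow> component a = Poly_Mapping.lookup c"
  using the1_equality[OF direct_sum[of a, folded is_decomposition_def]] by (simp add: component_def)

lemma decomposition_exists: obtains c where "is_decomposition a c" "component a = Poly_Mapping.lookup c"
  using ex1_implies_ex[OF direct_sum[of a, folded is_decomposition_def]] component_eq by blast

lemma component_in: "t \<in> T \<Longrightarrow> component a t \<in> A t"
  by (rule decomposition_exists[of a]) (simp add: is_decomposition_def)

lemma component_add: "component (a + b) t = component a t + component b t"
proof -
  obtain c d where c: "is_decomposition a c" "component a = Poly_Mapping.lookup c"
    and d: "is_decomposition b d" "component b = Poly_Mapping.lookup d"
    using decomposition_exists by metis
  have "a + b = (\<Sum>t\<in>Poly_Mapping.keys (c + d). Poly_Mapping.lookup (c + d) t)"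
    using c(1) d(1) setsum_keys_plus_distrib[of "\<lambda>_ x. x" c d] by (simp add: is_decomposition_def)
  moreover have "Poly_Mapping.keys (c + d) \<subseteq> T"
    using c(1) d(1) Poly_Mapping.keys_add[of c d] unfolding is_decomposition_def by blast
  ultimately have "is_decomposition (a + b) (c + d)"
    using c(1) d(1) subspace_component
    unfolding is_decomposition_def by (simp add: lookup_add subspace_add)
  from component_eq[OF this] show ?thesis using c(2) d(2) by (simp add: lookup_add)
qed

lemma component_scale: "component (scale r a) t = scale r (component a t)"
proof -
  obtain c where c: "is_decomposition a c" "component a = Poly_Mapping.lookup c"
    using decomposition_exists by metis
  let ?d = "Poly_Mapping.map (scale r) c"
  have d: "Poly_Mapping.lookup ?d t = scale r (Poly_Mapping.lookup c t)" for t
    by (simp add: Poly_Mapping.map.rep_eq when_def)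
  have keys: "Poly_Mapping.keys ?d \<subseteq> Poly_Mapping.keys c" by (auto simp: in_keys_iff d)
  have "(\<Sum>t\<in>Poly_Mapping.keys ?d. Poly_Mapping.lookup ?d t) = (\<Sum>t\<in>Poly_Mapping.keys c. Poly_Mapping.lookup ?d t)"
    by (rule sum.mono_neutral_left) (use keys in \<open>auto simp: in_keys_iff\<close>)
  also have "\<dots> = scale r a"
    using c(1) by (simp add: d scale_sum_right is_decomposition_def)
  finally have "is_decomposition (scale r a) ?d"
    using c(1) keys subspace_component
    unfolding is_decomposition_def by (auto simp: d subspace_scale)
  from component_eq[OF this] show ?thesis using c(2) d by simp
qed

lemma component_linear: "Vector_Spaces.linear scale scale (\<lambda>a. component a t)"
  by (auto simp: Vector_Spaces.linear_iff component_add component_scale vector_space_axioms)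

lemma component_homogeneous:
  assumes "s \<in> T" "a \<in> A s"
  shows "component a t = (if t = s then a else 0)"
proof -
  have "is_decomposition a (Poly_Mapping.single s a)"
    using assms subspace_0[OF subspace_component]
    by (cases "a = 0") (auto simp: is_decomposition_def lookup_single when_def)
  from component_eq[OF this] show ?thesis by (simp add: lookup_single when_def)
qed

lemma component_sum:
  assumes "finite S" "S \<subseteq> T" "\<And>s. s \<in> S \<Longrightarrow> x s \<in> A s" "t \<in> S"
  shows "component (\<Sum>s\<in>S. x s) t = x t"
proof -
  have "component (\<Sum>s\<in>S. x s) t = (\<Sum>s\<in>S. component (x s) t)"
    by (rule self_pair.linear_sum[OF component_linear])
  also have "\<dots> = (\<Sum>s\<in>S. if t = s then x s else 0)"
    by (intro sum.cong refl component_homogeneous) (use assms in auto)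
  also have "\<dots> = x t" using assms by simp
  finally show ?thesis .
qed

text \<open>One vector \<open>a i\<close> serves all variables with index \<open>i\<close>, whatever
  their degree. Evaluation becomes a function of vectors from the whole algebra, linear in each,
  although different words use different components.\<close>

definition substitute :: "(nat \<Rightarrow> 'a) \<Rightarrow> nat \<times> 't \<Rightarrow> 'a" where
  "substitute a = (\<lambda>(i, t). component (a i) t)"

text \<open>The index \<open>i\<close> occurs in exactly one factor of a product; the other factor
  is constant in \<open>x\<close>, and bilinearity of \<open>mul\<close> applies.\<close>

lemma eval_word_linear:
  assumes "distinct (map fst (letters w))" "i \<in> fst ` set (letters w)"
  shows "Vector_Spaces.linear scale scale (\<lambda>x. eval_word mul (substitute (a(i := x))) w)"
  using assms
proof (induction w)
  case (Var x)
  then show ?case using component_linear by (cases x) (simp add: substitute_def)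
next
  case (Mul u v)
  have const: "eval_word mul (substitute (a(i := x))) w = eval_word mul (substitute a) w"
    if w: "i \<notin> fst ` set (letters w)" for x w
  proof (rule eval_word_cong)
    fix y assume "y \<in> set (letters w)"
    then have "fst y \<noteq> i" using w by blast
    then show "substitute (a(i := x)) y = substitute a y" by (simp add: substitute_def case_prod_beta)
  qed
  have disj: "fst ` set (letters u) \<inter> fst ` set (letters v) = {}" using Mul.prems(1) by simp
  show ?case
  proof (cases "i \<in> fst ` set (letters u)")
    case True
    then have notin: "i \<notin> fst ` set (letters v)" using disj by blast
    have "Vector_Spaces.linear scale scale (\<lambda>x. eval_word mul (substitute (a(i := x))) u)"
      by (rule Mul.IH(1)) (use Mul.prems(1) True in simp_all)
    from Vector_Spaces.linear_compose[OF this linear_left[of "eval_word mul (substitute a) v"]]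
    have "Vector_Spaces.linear scale scale
      (\<lambda>x. mul (eval_word mul (substitute (a(i := x))) u) (eval_word mul (substitute a) v))"
      by (simp add: o_def)
    then show ?thesis by (simp only: eval_word.simps const[OF notin])
  next
    case False
    then have "i \<in> fst ` set (letters v)" using Mul.prems(2) by auto
    then have "Vector_Spaces.linear scale scale (\<lambda>x. eval_word mul (substitute (a(i := x))) v)"
      by (intro Mul.IH(2)) (use Mul.prems(1) in simp_all)
    from Vector_Spaces.linear_compose[OF this linear_right[of "eval_word mul (substitute a) u"]]
    have "Vector_Spaces.linear scale scale
      (\<lambda>x. mul (eval_word mul (substitute a) u) (eval_word mul (substitute (a(i := x))) v))"
      by (simp add: o_def)
    then show ?thesis by (simp only: eval_word.simps const[OF False])
  qed
qed

lemma eval_poly_linear: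
  assumes "f \<in> multilinear_polys n T" "i \<in> {1..n}"
  shows "Vector_Spaces.linear scale scale (\<lambda>x. eval_poly scale mul (substitute (a(i := x))) f)"
  unfolding eval_poly_def
proof (intro self_pair.linear_compose_sum ballI self_pair.linear_compose_scale_right)
  fix w assume "w \<in> Poly_Mapping.keys f"
  then have "w \<in> multilinear_words n T" using assms(1) by (auto simp: multilinear_polys_def)
  from multilinear_word_letters[OF this]
  show "Vector_Spaces.linear scale scale (\<lambda>x. eval_word mul (substitute (a(i := x))) w)"
    using assms(2) by (intro eval_word_linear) auto
qed

lemma eval_poly_cong:
  assumes "f \<in> multilinear_polys n T"
    and "\<And>w i t. w \<in> Poly_Mapping.keys f \<Longrightarrow> (i, t) \<in> set (letters w) \<Longrightarrow> i \<in> {1..n} \<Longrightarrow> t \<in> T \<Longrightarrow>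
      \<psi> (i, t) = \<psi>' (i, t)"
  shows "eval_poly scale mul \<psi> f = eval_poly scale mul \<psi>' f"
  unfolding eval_poly_def
proof (intro sum.cong refl arg_cong[where f = "scale _"] eval_word_cong)
  fix w x assume w: "w \<in> Poly_Mapping.keys f" and x: "x \<in> set (letters w)"
  then have "w \<in> multilinear_words n T" using assms(1) by (auto simp: multilinear_polys_def)
  from multilinear_word_letters[OF this] have "fst x \<in> {1..n}" "snd x \<in> T" using x by auto
  then show "\<psi> x = \<psi>' x" using assms(2)[OF w, of "fst x" "snd x"] x by simp
qed

text \<open>Slots are released one at a time: \<open>J\<close> collects those whose entries need not
  be basis vectors. Releasing \<open>j\<close> uses that a linear map vanishing on \<open>B\<close>
  vanishes on its span.\<close>

lemma eval_poly_vanishes: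
  assumes f: "f \<in> multilinear_polys n T" and B: "span B = UNIV"
    and zero: "\<And>b. b \<in> {1..n} \<rightarrow>\<^sub>E B \<Longrightarrow> eval_poly scale mul (substitute b) f = 0"
  shows "eval_poly scale mul (substitute a) f = 0"
proof -
  have "\<forall>a. (\<forall>i\<in>{1..n} - J. a i \<in> B) \<longrightarrow> eval_poly scale mul (substitute a) f = 0"
    if "J \<subseteq> {1..n}" for J
    using finite_subset[OF that finite_atLeastAtMost] that
  proof (induction J rule: finite_induct)
    case empty
    show ?case
    proof (intro allI impI)
      fix a assume a: "\<forall>i\<in>{1..n} - {}. a i \<in> B"
      \<comment> \<open>Entries beyond \<open>{1..n}\<close> do not influence the value; restricting
        them away gives the extensional tuple that \<open>zero\<close> expects.\<close>
      have "eval_poly scale mul (substitute a) f = eval_poly scale mul (substitute (restrict a {1..n})) f"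
        by (rule eval_poly_cong[OF f]) (simp add: substitute_def)
      also have "\<dots> = 0" by (rule zero) (use a in auto)
      finally show "eval_poly scale mul (substitute a) f = 0" .
    qed
  next
    case (insert j J)
    show ?case
    proof (intro allI impI)
      fix a assume a: "\<forall>i\<in>{1..n} - insert j J. a i \<in> B"
      let ?F = "\<lambda>x. eval_poly scale mul (substitute (a(j := x))) f"
      have "?F x = 0" if "x \<in> B" for x
      proof -
        have "\<forall>i\<in>{1..n} - J. (a(j := x)) i \<in> B" using a that by auto
        then show ?thesis using insert by blast
      qed
      moreover have "Vector_Spaces.linear scale scale ?F"
        by (rule eval_poly_linear[OF f]) (use insert.prems in auto)
      ultimately have "?F (a j) = 0"
        using self_pair.linear_eq_0_on_span[of ?F B "a j"] B by auto
      then show "eval_poly scale mul (substitute a) f = 0" by simp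
    qed
  qed
  from this[of "{1..n}"] show ?thesis by simp
qed

text \<open>A homogeneous assignment may choose nonzero values in infinitely many degrees, whereas
  one vector has only finitely many nonzero components. But only the finite set \<open>S\<close> of
  degrees occurring in \<open>f\<close> matters: for each \<open>i\<close> the values in these
  degrees are summed into one vector and recovered as its components.\<close>

lemma multilinear_identity_iff:
  assumes f: "f \<in> multilinear_polys n T"
  shows "f \<in> graded_identities scale mul T A \<longleftrightarrow> (\<forall>a. eval_poly scale mul (substitute a) f = 0)"
proof
  assume "f \<in> graded_identities scale mul T A"
  then show "\<forall>a. eval_poly scale mul (substitute a) f = 0"
    by (auto simp: graded_identities_def graded_vars_def substitute_def component_in)
next
  assume zero: "\<forall>a. eval_poly scale mul (substitute a) f = 0"
  have "set (letters w) \<subseteq> graded_vars T" if "w \<in> Poly_Mapping.keys f" for w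
  proof -
    have "w \<in> multilinear_words n T" using that f by (auto simp: multilinear_polys_def)
    note letters = multilinear_word_letters[OF this]
    show ?thesis
    proof
      fix x assume "x \<in> set (letters w)"
      then have "fst x \<in> {1..n}" "snd x \<in> T" using letters(2,3) by blast+
      then show "x \<in> graded_vars T" by (cases x) (simp add: graded_vars_def)
    qed
  qed
  then have "f \<in> free_algebra (graded_vars T)" by (auto simp: free_algebra_def)
  moreover have "eval_poly scale mul \<psi> f = 0" if \<psi>: "\<forall>(i, t)\<in>graded_vars T. \<psi> (i, t) \<in> A t" for \<psi>
  proof -
    define S where "S = (\<Union>w\<in>Poly_Mapping.keys f. snd ` set (letters w)) \<inter> T"
    have S: "finite S" "S \<subseteq> T" by (auto simp: S_def)
    have "eval_poly scale mul \<psi> f = eval_poly scale mul (substitute (\<lambda>i. \<Sum>s\<in>S. \<psi> (i, s))) f"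
    proof (rule eval_poly_cong[OF f])
      fix w i t
      assume "w \<in> Poly_Mapping.keys f" "(i, t) \<in> set (letters w)" and i: "i \<in> {1..n}" and "t \<in> T"
      then have "t \<in> S" by (force simp: S_def)
      moreover have "\<psi> (i, s) \<in> A s" if "s \<in> S" for s
        using \<psi> i S that by (auto simp: graded_vars_def)
      ultimately show "\<psi> (i, t) = substitute (\<lambda>i. \<Sum>s\<in>S. \<psi> (i, s)) (i, t)"
        using component_sum[OF S, of "\<lambda>s. \<psi> (i, s)" t] by (simp add: substitute_def)
    qed
    then show ?thesis using zero by simp
  qed
  ultimately show "f \<in> graded_identities scale mul T A" by (auto simp: graded_identities_def)
qed

end

section \<open>Embedding of the graded cocharacter module\<close>

lemma sn_submodule_carrier_sn_mod: "place.invariant n W \<Longrightarrow> sn_submodule n (place.sn_mod W) W"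
  by (simp add: place.sn_submodule_sn_mod place.invariant_def)

locale graded_algebra_basis = graded_algebra scale mul T A
  for scale :: "'f::field_char_0 \<Rightarrow> 'a::ab_group_add \<Rightarrow> 'a" and mul and T :: "'t set" and A +
  fixes B :: "'a set" and n :: nat
  assumes finite_B: "finite B" and independent_B: "independent B" and span_B: "span B = UNIV"
begin

abbreviation "polys \<equiv> multilinear_polys n T :: ((nat \<times> 't) word \<Rightarrow>\<^sub>0 'f) set"

text \<open>The coordinates of all values at basis tuples. The value \<open>0\<close> off
  \<open>tuples n B\<close> keeps every table in a finite dimensional space of functions.\<close>

definition table :: "((nat \<times> 't) word \<Rightarrow>\<^sub>0 'f) \<Rightarrow> (nat \<Rightarrow> 'a) \<times> 'a \<Rightarrow> 'f" where
  "table f = (\<lambda>(b, c). if (b, c) \<in> tuples n B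
    then representation B (eval_poly scale mul (substitute b) f) c else 0)"

lemma table_add: "table (f + g) = table f + table g"
  using span_B independent_B
  by (auto simp: table_def fun_eq_iff eval_poly_add representation_add)

lemma table_scale: "table (coeff_scale c f) = fun_scale c (table f)"
  using span_B independent_B
  by (auto simp: table_def fun_eq_iff eval_poly_scale representation_scale fun_scale_def)

lemma table_rename:
  assumes p: "p permutes {1..n}"
  shows "table (rename_poly p f) = place_act p (table f)"
proof
  fix k :: "(nat \<Rightarrow> 'a) \<times> 'a"
  obtain b c where k: "k = (b, c)" by (cases k)
  have perm_tuple: "b \<circ> q \<in> {1..n} \<rightarrow>\<^sub>E B" if q: "q permutes {1..n}" and b: "b \<in> {1..n} \<rightarrow>\<^sub>E B" for q b
  proof (rule PiE_I)
    show "(b \<circ> q) x \<in> B" if "x \<in> {1..n}" for x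
      using PiE_mem[OF b, of "q x"] permutes_in_image[OF q, of x] that by simp
    show "(b \<circ> q) x = undefined" if "x \<notin> {1..n}" for x
      using PiE_arb[OF b that] permutes_not_in[OF q that] by simp
  qed
  \<comment> \<open>Tables are cut off outside \<open>tuples n B\<close>, so permuting places must
    neither enter nor leave this set.\<close>
  have iff: "b \<circ> p \<in> {1..n} \<rightarrow>\<^sub>E B \<longleftrightarrow> b \<in> {1..n} \<rightarrow>\<^sub>E B"
    using perm_tuple[OF p, of b] perm_tuple[OF permutes_inv[OF p], of "b \<circ> p"] permutes_inv_o(1)[OF p]
    by (auto simp: o_assoc[symmetric])
  have "substitute b \<circ> (\<lambda>(i, t). (p i, t)) = substitute (b \<circ> p)"
    by (auto simp: substitute_def fun_eq_iff)
  then show "table (rename_poly p f) k = place_act p (table f) k"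
    using iff by (simp add: k table_def place_act_def tuples_def eval_poly_rename)
qed

text \<open>Multilinearity reduces arbitrary substitutions to basis tuples, and homogeneous
  assignments reduce to component substitutions. The identities thus become the kernel of
  \<open>table\<close> on \<open>polys\<close>.\<close>

lemma table_eq_0_iff:
  assumes f: "f \<in> polys"
  shows "table f = 0 \<longleftrightarrow> f \<in> graded_identities scale mul T A"
proof
  assume "f \<in> graded_identities scale mul T A"
  then show "table f = 0"
    using f by (auto simp: multilinear_identity_iff table_def representation_zero)
next
  assume table: "table f = 0"
  have "eval_poly scale mul (substitute b) f = 0" if b: "b \<in> {1..n} \<rightarrow>\<^sub>E B" for b
  proof -
    let ?v = "eval_poly scale mul (substitute b) f"
    have "representation B ?v c = 0" for c
    proof (cases "c \<in> B")
      case True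
      then show ?thesis using fun_cong[OF table, of "(b, c)"] b by (simp add: table_def tuples_def)
    qed (use representation_ne_zero in blast)
    moreover have "(\<Sum>c | representation B ?v c \<noteq> 0. scale (representation B ?v c) c) = ?v"
      by (rule sum_nonzero_representation_eq[OF independent_B]) (simp add: span_B)
    ultimately show ?thesis by simp
  qed
  then show "f \<in> graded_identities scale mul T A"
    using multilinear_identity_iff[OF f] eval_poly_vanishes[OF f span_B] by blast
qed

definition tables :: "((nat \<Rightarrow> 'a) \<times> 'a \<Rightarrow> 'f) set" where
  "tables = table ` polys"

lemma zero_in_polys: "0 \<in> polys"
  by (simp add: multilinear_polys_def)

lemma table_0: "table 0 = 0"
  using table_add[of 0 0] by simp

lemma invariant_tables: "place.invariant n tables"
  unfolding place.invariant_def fun_space.subspace_def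
proof (intro conjI ballI allI impI)
  show "0 \<in> tables" using table_0 zero_in_polys unfolding tables_def by (metis imageI)
  fix F G c p
  assume F: "F \<in> tables"
  then obtain f where f: "f \<in> polys" "F = table f" by (auto simp: tables_def)
  show "fun_scale c F \<in> tables"
    unfolding f(2) table_scale[symmetric] tables_def by (intro imageI multilinear_polys_scale f(1))
  assume "G \<in> tables"
  then obtain g where g: "g \<in> polys" "G = table g" by (auto simp: tables_def)
  show "F + G \<in> tables"
    unfolding f(2) g(2) table_add[symmetric] tables_def by (intro imageI multilinear_polys_add f(1) g(1))
next
  fix p assume p: "p permutes {1..n}"
  show "place_act p ` tables \<subseteq> tables"
    unfolding tables_def image_image table_rename[OF p, symmetric]
    using rename_poly_multilinear[OF _ p] by blast
qed

lemma subspace_tables: "fun_space.subspace tables"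
  using invariant_tables by (simp add: place.invariant_def)

lemma tables_support: "F \<in> tables \<Longrightarrow> k \<notin> tuples n B \<Longrightarrow> F k = 0"
  by (auto simp: tables_def table_def split: prod.splits)

section \<open>Cosets of identities as fibres of the table map\<close>

definition fibre :: "((nat \<Rightarrow> 'a) \<times> 'a \<Rightarrow> 'f) \<Rightarrow> ((nat \<times> 't) word \<Rightarrow>\<^sub>0 'f) set" where
  "fibre F = {f \<in> polys. table f = F}"

abbreviation "cocharacter \<equiv> graded_cocharacter_module scale mul T A n"

text \<open>Cosets of a kernel are fibres. The isomorphism runs from tables to cosets because a
  coset is itself a set of polynomials, so \<open>fibre\<close> involves no choice of
  representative.\<close>

lemma coset_eq_fibre:
  assumes f: "f \<in> polys"
  shows "(polys \<inter> graded_identities scale mul T A) +>\<^bsub>multilinear_module n T\<^esub> f = fibre (table f)"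
proof -
  have "(polys \<inter> graded_identities scale mul T A) +>\<^bsub>multilinear_module n T\<^esub> f =
      {h + f |h. h \<in> polys \<and> table h = 0}"
    using table_eq_0_iff by (auto simp: a_r_coset_def' multilinear_module_def)
  also have "\<dots> = fibre (table f)"
  proof (intro equalityI subsetI)
    fix g assume g: "g \<in> fibre (table f)"
    have "g + coeff_scale (- 1) f \<in> polys"
      using g f by (intro multilinear_polys_add multilinear_polys_scale) (simp add: fibre_def)
    moreover have "table (g + coeff_scale (- 1) f) = 0"
      using g by (simp add: table_add table_scale fibre_def fun_eq_iff fun_scale_def)
    moreover have "g = (g + coeff_scale (- 1) f) + f"
      by (intro poly_mapping_eqI) (simp add: lookup_add lookup_coeff_scale)
    ultimately show "g \<in> {h + f |h. h \<in> polys \<and> table h = 0}" by blast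
  next
    fix g assume "g \<in> {h + f |h. h \<in> polys \<and> table h = 0}"
    then show "g \<in> fibre (table f)"
      using f by (auto simp: fibre_def table_add multilinear_polys_add)
  qed
  finally show ?thesis .
qed

lemma fibre_nonempty: "F \<in> tables \<Longrightarrow> \<exists>f. f \<in> fibre F"
  by (auto simp: tables_def fibre_def)

lemma fibreD: "f \<in> fibre F \<Longrightarrow> f \<in> polys \<and> table f = F"
  by (simp add: fibre_def)

lemma inj_fibre: "inj_on fibre tables"
  by (rule inj_onI) (metis fibreD fibre_nonempty)

lemma carrier_cocharacter: "carrier cocharacter = fibre ` tables"
proof -
  have "carrier cocharacter = (\<Union>f\<in>polys. {fibre (table f)})"
    using coset_eq_fibre
    by (auto simp: graded_cocharacter_module_def sn_quotient_def A_RCOSETS_def' multilinear_module_def)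
  then show ?thesis by (auto simp: tables_def)
qed

lemma cocharacter_zero: "\<zero>\<^bsub>cocharacter\<^esub> = fibre 0"
  using table_eq_0_iff by (auto simp: graded_cocharacter_module_def sn_quotient_def fibre_def)

lemma cocharacter_add:
  assumes F: "F \<in> tables" and G: "G \<in> tables"
  shows "fibre F \<oplus>\<^bsub>cocharacter\<^esub> fibre G = fibre (F + G)"
proof -
  have "fibre F \<oplus>\<^bsub>cocharacter\<^esub> fibre G = {f + g |f g. f \<in> fibre F \<and> g \<in> fibre G}"
    by (auto simp: graded_cocharacter_module_def sn_quotient_def set_add_def' multilinear_module_def)
  also have "\<dots> = fibre (F + G)"
  proof (intro equalityI subsetI)
    fix h assume h: "h \<in> fibre (F + G)"
    obtain f where f: "f \<in> fibre F" using fibre_nonempty[OF F] by blast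
    have "h + coeff_scale (- 1) f \<in> fibre G"
      using fibreD[OF h] fibreD[OF f]
      by (simp add: fibre_def multilinear_polys_add multilinear_polys_scale table_add table_scale
          fun_eq_iff fun_scale_def)
    moreover have "h = f + (h + coeff_scale (- 1) f)"
      by (intro poly_mapping_eqI) (simp add: lookup_add lookup_coeff_scale)
    ultimately show "h \<in> {f + g |f g. f \<in> fibre F \<and> g \<in> fibre G}" using f by blast
  qed (auto simp: fibre_def table_add multilinear_polys_add)
  finally show ?thesis .
qed

text \<open>In the quotient a scalar acts by a union over representatives. All members of the union
  are the same coset, and the union equals it because the fibre is nonempty.\<close>

lemma cocharacter_smult:
  assumes F: "F \<in> tables"
  shows "c \<odot>\<^bsub>cocharacter\<^esub> fibre F = fibre (fun_scale c F)"
proof -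
  have "(polys \<inter> graded_identities scale mul T A) +>\<^bsub>multilinear_module n T\<^esub> coeff_scale c f =
      fibre (fun_scale c F)" if "f \<in> fibre F" for f
    using coset_eq_fibre[OF multilinear_polys_scale, of f c] fibreD[OF that] by (simp add: table_scale)
  then have "c \<odot>\<^bsub>cocharacter\<^esub> fibre F = (\<Union>f\<in>fibre F. fibre (fun_scale c F))"
    by (simp add: graded_cocharacter_module_def sn_quotient_def) (simp add: multilinear_module_def)
  then show ?thesis using fibre_nonempty[OF F] by auto
qed

lemma cocharacter_act:
  assumes F: "F \<in> tables" and p: "p permutes {1..n}"
  shows "act cocharacter p (fibre F) = fibre (place_act p F)"
proof -
  have "(polys \<inter> graded_identities scale mul T A) +>\<^bsub>multilinear_module n T\<^esub> rename_poly p f =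
      fibre (place_act p F)" if "f \<in> fibre F" for f
    using coset_eq_fibre[OF rename_poly_multilinear[OF _ p], of f] fibreD[OF that]
    by (simp add: table_rename[OF p])
  then have "act cocharacter p (fibre F) = (\<Union>f\<in>fibre F. fibre (place_act p F))"
    by (simp add: graded_cocharacter_module_def sn_quotient_def) (simp add: multilinear_module_def)
  then show ?thesis using fibre_nonempty[OF F] by auto
qed

lemma sn_iso_fibre: "sn_iso n fibre (place.sn_mod tables) cocharacter"
  unfolding sn_iso_def place.sn_mod_simps
  using inj_fibre
  by (auto simp: bij_betw_def carrier_cocharacter cocharacter_add cocharacter_smult
      cocharacter_act sym_group_carrier)

lemma abelian_group_cocharacter: "abelian_group cocharacter"
proof (rule abelian_groupI)
  fix x assume "x \<in> carrier cocharacter"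
  then obtain F where F: "F \<in> tables" "x = fibre F" by (auto simp: carrier_cocharacter)
  have "- F \<in> tables" using fun_space.subspace_neg[OF subspace_tables F(1)] .
  then show "\<exists>y\<in>carrier cocharacter. y \<oplus>\<^bsub>cocharacter\<^esub> x = \<zero>\<^bsub>cocharacter\<^esub>"
    using F by (intro bexI[of _ "fibre (- F)"])
      (auto simp: carrier_cocharacter cocharacter_add cocharacter_zero)
qed (use subspace_tables in \<open>auto simp: carrier_cocharacter cocharacter_add cocharacter_zero
    fun_space.subspace_add fun_space.subspace_0 add.assoc add.commute add.left_commute\<close>)

section \<open>Bounds for the multiplicities and the colength\<close>

lemma cocharacter_decomposition_exists: "\<exists>D. irreducible_decomposition n cocharacter D"
proof -
  let ?S = "(\<lambda>z k. if k \<in> tuples n B \<and> k = z then 1 else 0) ` (\<lambda>k. k) ` tuples n B :: (_ \<Rightarrow> 'f) set"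
  \<comment> \<open>Tables are supported on a finite set, so indicators of single points span them;
    here \<open>st\<close> is the identity.\<close>
  have "tables \<subseteq> fun_space.span ?S"
    by (intro subsetI in_span_fibre_indicators finite_tuples finite_B) (auto dest: tables_support)
  then obtain D where D: "irreducible_decomposition n (place.sn_mod tables) D"
    using place.irreducible_decomposition_exists[OF invariant_tables, of ?S]
      finite_tuples[OF finite_B] by auto
  interpret sn_iso_pair n fibre "place.sn_mod tables" cocharacter
    by (intro sn_iso_pair.intro sn_iso_fibre abelian_group_cocharacter
        place.abelian_group_sn_mod subspace_tables)
  show ?thesis using irreducible_decomposition_image[OF D] by blast
qed

lemma graded_multiplicity_bound:
  assumes \<mu>: "\<mu> \<in> partitions n"
  shows "graded_multiplicity scale mul T A \<mu> \<le>
    (if length \<mu> \<le> card B then card B * (n + 1) ^ (card B)\<^sup>2 else 0)"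
proof -
  have n: "sum_list \<mu> = n" using \<mu> by (simp add: partitions_def)
  let ?S = "specht_module \<mu> :: ('f, _) sn_module"
  have "\<exists>m D. irreducible_decomposition n cocharacter D \<and>
      m = card {U \<in> D. sn_isomorphic n (cocharacter\<lparr>carrier := U\<rparr>) ?S}"
    using cocharacter_decomposition_exists by blast
  \<comment> \<open>Existence guarantees that the chosen number is the count in some decomposition
    \<open>D\<close>, about which nothing more is known.\<close>
  from someI_ex[OF this] obtain D where D: "irreducible_decomposition n cocharacter D"
    and m: "sn_multiplicity n cocharacter ?S =
      card {U \<in> D. sn_isomorphic n (cocharacter\<lparr>carrier := U\<rparr>) ?S}"
    unfolding sn_multiplicity_def by blast
  \<comment> \<open>The count is carried from cosets to tables, against the direction of
    \<open>fibre\<close>.\<close>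
  define \<phi> where "\<phi> = the_inv_into (carrier (place.sn_mod tables)) fibre"
  interpret sn_iso_pair n \<phi> cocharacter "place.sn_mod tables"
    unfolding \<phi>_def
    by (intro sn_iso_pair.intro sn_iso_inv sn_iso_fibre abelian_group_cocharacter
        place.abelian_group_sn_mod subspace_tables)
      (simp add: sn_submodule_carrier_sn_mod invariant_tables)
  have "sn_multiplicity n cocharacter ?S \<le>
      card {V \<in> (`) \<phi> ` D. sn_isomorphic n (place.sn_mod V) ?S}"
    unfolding m using card_isomorphic_summands_le[OF D, of ?S] by simp
  also have "\<dots> \<le> (if length \<mu> \<le> card B then card B * (n + 1) ^ (card B)\<^sup>2 else 0)"
    by (intro specht_multiplicity_bound[where W = tables] finite_B subspace_tables \<mu>
        irreducible_decomposition_image[OF D]) (rule tables_support)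
  finally show ?thesis by (simp add: graded_multiplicity_def n)
qed

lemma graded_colength_bound:
  "graded_colength scale mul T A n \<le> card B * (n + 1) ^ ((card B)\<^sup>2 + card B)"
\<comment> \<open>A sum over an infinite index set is \<open>0\<close> by convention, which settles
  the other case.\<close>
proof (cases "finite (partitions n)")
  case True
  let ?b = "card B * (n + 1) ^ (card B)\<^sup>2"
  have "graded_colength scale mul T A n \<le> (\<Sum>\<mu>\<in>partitions n. if length \<mu> \<le> card B then ?b else 0)"
    unfolding graded_colength_def by (intro sum_mono graded_multiplicity_bound)
  also have "\<dots> = card {\<mu> \<in> partitions n. length \<mu> \<le> card B} * ?b"
    using True by (simp flip: sum.inter_filter)
  also have "\<dots> \<le> (n + 1) ^ card B * ?b" by (intro mult_right_mono card_partitions_le) simp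
  also have "\<dots> = card B * (n + 1) ^ ((card B)\<^sup>2 + card B)" by (simp add: power_add)
  finally show ?thesis .
qed (simp add: graded_colength_def)

end

theorem corollary5p6:
  fixes scale :: "'f::field_char_0 \<Rightarrow> 'a::ab_group_add \<Rightarrow> 'a"
    and mul :: "'a \<Rightarrow> 'a \<Rightarrow> 'a"
    and T :: "'t set"
    and A :: "'t \<Rightarrow> 'a set"
    and n :: nat
  assumes "graded_algebra scale mul T A"
    and "\<exists>B. finite_dimensional_vector_space scale B"
    and "n \<ge> 1"
  shows "graded_colength scale mul T A n \<le>
    vector_space.dim scale UNIV *
      (n + 1) ^ ((vector_space.dim scale UNIV)\<^sup>2 + vector_space.dim scale UNIV)"
proof -
  obtain B where B: "finite_dimensional_vector_space scale B" using assms(2) by blast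
  interpret fin: finite_dimensional_vector_space scale B by (rule B)
  interpret graded_algebra_basis scale mul T A B n
    by (intro graded_algebra_basis.intro graded_algebra_basis_axioms.intro assms(1)
        fin.finite_Basis fin.independent_Basis fin.span_Basis)
  show ?thesis using graded_colength_bound by (simp only: fin.dim_UNIV)
qed

end
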